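(* Let $V$ be a meromorphic open-string vertex algebra and $N\in\mathbb Z$. The category $\mathcal C_N$ of left $V$-modules is closed under taking submodules and quotients: if $W\in\mathcal C_N$ and $T\subseteq W$ is a $V$-submodule, then $T\in\mathcal C_N$ and $W/T\in\mathcal C_N$.
   Context: $\mathbb N=\{0,1,2,\dots\}$. A meromorphic open-string vertex algebra (MOSVA) is a $\mathbb Z$-graded complex vector space $V=\coprod_{n\in\mathbb Z}V_{(n)}$ with a linear map $Y:V\otimes V\to V[[x,x^{-1}]]$, $u\otimes v\mapsto Y(u,x)v$, and $\mathbf 1\in V$ such that: $V_{(n)}=0$ for $n$ sufficiently negative; $[\mathbf d_V,Y(v,x)]=x\frac{d}{dx}Y(v,x)+Y(\mathbf d_Vv,x)$, where $\mathbf d_Vv=nv$ for $v\in V_{(n)}$ (write $\mathrm{wt}\,v=n$); $Y(\mathbf 1,x)=1_V$; $Y(u,x)\mathbf 1\in V[[x]]$ with constant term $u$; with $D_Vv=\lim_{x\to0}\frac{d}{dx}Y(v,x)\mathbf 1$ one has $\frac{d}{dx}Y(v,x)=Y(D_Vv,x)=[D_V,Y(v,x)]$; for all $u_1,v\in V$ there is $p\in\mathbb N$ such that for all $u_2\in V$, $(x_0+x_2)^pY(u_1,x_0+x_2)Y(u_2,x_2)v=(x_0+x_2)^pY(Y(u_1,x_0)u_2,x_2)v$. A left $V$-module is a $\mathbb C$-graded space $W=\coprod_{m\in\mathbb C}W_{[m]}$ with $Y_W:V\otimes W\to W[[x,x^{-1}]]$ and $\mathbf d_W$ ($\mathbf d_Ww=mw$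 on $W_{[m]}$) such that: $W_{[m]}=0$ for $\mathrm{Re}(m)$ sufficiently negative; $[\mathbf d_W,Y_W(u,x)]=Y_W(\mathbf d_Vu,x)+x\frac{d}{dx}Y_W(u,x)$; $Y_W(\mathbf 1,x)=1_W$; $\frac{d}{dx}Y_W(u,x)=Y_W(D_Vu,x)$; for all $v_1\in V,w\in W$ there is $p\in\mathbb N$ such that for all $v_2\in V$, $(x_0+x_2)^pY_W(v_1,x_0+x_2)Y_W(v_2,x_2)w=(x_0+x_2)^pY_W(Y(v_1,x_0)v_2,x_2)w$. $W'=\coprod_mW_{[m]}^*$, $\overline W=\prod_mW_{[m]}$. $\widehat{(W)}_\zeta$ is the space of maps $f:\mathbb C^\times\to\overline W$ such that each $\langle w',f(\zeta)\rangle$ ($w'\in W'$) is a rational function with only possible pole at $\zeta=0$, and there are an integer $p$ and $g(x)\in W[[x]]$ with $\zeta^p\langle w',f(\zeta)\rangle=\langle w',g(\zeta)\rangle$, a polynomial, for all $w'\in W'$. For left $V$-modules $W_1,W_2$, the space $\mathcal H_N(W_1,W_2)$ is the subspace of $\mathrm{Hom}_{\mathbb C}(W_1,\widehat{(W_2)}_\zeta)$ spanned by the $\phi:w_1\mapsto\phi(\zeta)w_1$ satisfying: (1) ($\mathbf d$-conjugation) there is $n\in\mathbb Z$, the weight $\mathrm{wt}\,\phi$, with $a^{\mathbf d_{W_2}}(\phi(\zeta)w_1)=a^n\phi(a\zeta)a^{\mathbf d_{W_1}}w_1$ for $a\in\mathbb C^\times$, $w_1\in W_1$. (2) (composability) for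 $k,l\in\mathbb N$, $v_1,\dots,v_{k+l}\in V$, $w_1\in W_1$, $w_2'\in W_2'$, the series $\langle w_2',Y_{W_2}(v_1,z_1)\cdots Y_{W_2}(v_k,z_k)\phi(\zeta)Y_{W_1}(v_{k+1},z_{k+1})\cdots Y_{W_1}(v_{k+l},z_{k+l})w_1\rangle$ converges absolutely for $|z_1|>\cdots>|z_k|>|\zeta|>|z_{k+1}|>\cdots>|z_{k+l}|>0$ to a rational function $f$ with only possible poles $z_i=0$, $\zeta=0$, $z_i=z_j$, $z_i=\zeta$; moreover there are $r_i\in\mathbb N$ depending only on $(v_i,w_1)$, $m\in\mathbb N$ depending only on $(\phi,w_1)$, $p_{ij}\in\mathbb N$ depending only on $(v_i,v_j)$, $s_i\in\mathbb N$ depending only on $(v_i,\phi)$, and $g\in W_2[[z_1,\dots,z_{k+l},\zeta]]$ such that for all $w_2'$, $\zeta^m\prod_iz_i^{r_i}\prod_{i<j}(z_i-z_j)^{p_{ij}}\prod_i(z_i-\zeta)^{s_i}f$ is a polynomial equal to $\langle w_2',g\rangle$. (3) ($N$-weight-degree) for $l\ge1$ and homogeneous $v_i$, expand $f$ in the region $|z_{k+l}|>|z_1-z_{k+l}|>\cdots>|z_k-z_{k+l}|>|\zeta-z_{k+l}|>|z_{k+1}-z_{k+l}|>\cdots>|z_{k+l-1}-z_{k+l}|>0$ as a Laurent series in $z_i-z_{k+l}$ ($i\le k+l-1$) and $\zeta-z_{k+l}$ with coefficients Laurent polynomials in $z_{k+l}$; then each monomial in these differences has total degree at least $N-\sum_{i=1}^{k+l}\mathrm{wt}\,v_i-\mathrm{wt}\,\phi$.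 $\mathcal C_N$ is the category whose objects are the left $V$-modules $W$ such that for every $V$-submodule $W_2\subseteq W$ there is a vector subspace $W_1\subseteq W$ with $W=W_1\amalg W_2$ as vector spaces, with projections $\pi_{W_1}:W\to W_1$, $\pi_{W_2}:W\to W_2$, such that $\pi_{W_2}Y_W(v,x)\pi_{W_1}\in\mathcal H_N(W_1,W_2)$ for every $v\in V$ (as a map on $W_1$, with $x=\zeta$), where $W_1$ is regarded as a $V$-module with vertex operator $v\mapsto\pi_{W_1}Y_W(v,x)$. Morphisms are left $V$-module homomorphisms. *)

theory Defs
  imports "HOL-Analysis.Analysis" "HOL-Algebra.AbelCoset" "HOL-Algebra.Module"
begin

section \<open>Graded complex vector spaces\<close>

definition CC :: "complex ring" where
  "CC = \<lparr>carrier = UNIV, mult = (*), one = 1, zero = 0, add = (+)\<rparr>"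

text \<open>
  A complex vector space is a \<^locale>\<open>module\<close> over \<open>CC\<close>; the fields \<open>mult\<close> and \<open>one\<close> that the
  record type \<open>module\<close> inherits from \<open>ring\<close> are never used.  \<open>Yop W v w n\<close> is the coefficient
  of \<open>x\<^sup>n\<close> in \<open>Y(v,x)w\<close> (not the mode \<open>v\<^sub>n\<close>, which is the coefficient of \<open>x\<^sup>-\<^sup>n\<^sup>-\<^sup>1\<close>).
\<close>

record ('i, 'v, 'w) vertex_space = "(complex, 'w) module" +
  grade :: "'i \<Rightarrow> 'w set"
  Yop :: "'v \<Rightarrow> 'w \<Rightarrow> int \<Rightarrow> 'w"

record 'v vertex_algebra = "(int, 'v, 'v) vertex_space" +
  vac :: 'v

type_synonym ('v, 'w) left_mod = "(complex, 'v, 'w) vertex_space"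

definition is_decomp ::
  "('i, 'v, 'w, 'z) vertex_space_scheme \<Rightarrow> 'w \<Rightarrow> ('i \<Rightarrow> 'w) \<Rightarrow> bool" where
  "is_decomp W w c \<longleftrightarrow>
     (\<forall>i. c i \<in> grade W i) \<and> finite {i. c i \<noteq> \<zero>\<^bsub>W\<^esub>} \<and>
     w = (\<Oplus>\<^bsub>W\<^esub>i\<in>{i. c i \<noteq> \<zero>\<^bsub>W\<^esub>}. c i)"

definition graded_space :: "('i, 'v, 'w, 'z) vertex_space_scheme \<Rightarrow> bool" where
  "graded_space W \<longleftrightarrow>
     module CC W \<and> (\<forall>i. submodule (grade W i) CC W) \<and>
     (\<forall>w\<in>carrier W. \<exists>!c. is_decomp W w c)"

definition comps :: "('i, 'v, 'w, 'z) vertex_space_scheme \<Rightarrow> 'w \<Rightarrow> 'i \<Rightarrow> 'w" where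
  "comps W w = (THE c. is_decomp W w c)"

text \<open>The operator acting on \<open>grade W i\<close> as the scalar \<open>s i\<close>.\<close>

definition diag_op ::
  "('i, 'v, 'w, 'z) vertex_space_scheme \<Rightarrow> ('i \<Rightarrow> complex) \<Rightarrow> 'w \<Rightarrow> 'w" where
  "diag_op W s w = (\<Oplus>\<^bsub>W\<^esub>i\<in>{i. comps W w i \<noteq> \<zero>\<^bsub>W\<^esub>}. s i \<odot>\<^bsub>W\<^esub> comps W w i)"


section \<open>Meromorphic open-string vertex algebras and left modules\<close>

text \<open>\<open>Y : V \<otimes> W \<rightarrow> W[[x,x\<^sup>-\<^sup>1]]\<close> is linear.\<close>

definition vertex_map ::
  "(int, 'v, 'v, 'y) vertex_space_scheme \<Rightarrow> ('i, 'v, 'w, 'z) vertex_space_scheme \<Rightarrow> bool" where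
  "vertex_map V W \<longleftrightarrow>
     (\<forall>n. \<forall>u\<in>carrier V. \<forall>w\<in>carrier W. Yop W u w n \<in> carrier W) \<and>
     (\<forall>n. \<forall>u\<in>carrier V. \<forall>u'\<in>carrier V. \<forall>w\<in>carrier W.
        Yop W (u \<oplus>\<^bsub>V\<^esub> u') w n = Yop W u w n \<oplus>\<^bsub>W\<^esub> Yop W u' w n) \<and>
     (\<forall>n a. \<forall>u\<in>carrier V. \<forall>w\<in>carrier W.
        Yop W (a \<odot>\<^bsub>V\<^esub> u) w n = a \<odot>\<^bsub>W\<^esub> Yop W u w n) \<and>
     (\<forall>n. \<forall>u\<in>carrier V. \<forall>w\<in>carrier W. \<forall>w'\<in>carrier W.
        Yop W u (w \<oplus>\<^bsub>W\<^esub> w') n = Yop W u w n \<oplus>\<^bsub>W\<^esub> Yop W u w' n) \<and>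
     (\<forall>n a. \<forall>u\<in>carrier V. \<forall>w\<in>carrier W.
        Yop W u (a \<odot>\<^bsub>W\<^esub> w) n = a \<odot>\<^bsub>W\<^esub> Yop W u w n)"

text \<open>
  Formal series in \<open>x\<^sub>0, x\<^sub>2\<close> are given by their coefficients \<open>F a b\<close> of \<open>x\<^sub>0\<^sup>a x\<^sub>2\<^sup>b\<close>.
  Powers of \<open>x\<^sub>0 + x\<^sub>2\<close> are expanded in nonnegative powers of \<open>x\<^sub>2\<close>.  The sum in \<open>product_coeff\<close>
  is finite in a MOSVA or left module, the gradings being bounded below.
\<close>

definition product_coeff ::
  "('i, 'v, 'w, 'z) vertex_space_scheme \<Rightarrow> 'v \<Rightarrow> 'v \<Rightarrow> 'w \<Rightarrow> int \<Rightarrow> int \<Rightarrow> 'w" where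
  "product_coeff W u1 u2 w a b =
     (\<Oplus>\<^bsub>W\<^esub>j\<in>{j::nat. Yop W u2 w (b - int j) \<noteq> \<zero>\<^bsub>W\<^esub>}.
        (of_int (a + int j) gchoose j) \<odot>\<^bsub>W\<^esub> Yop W u1 (Yop W u2 w (b - int j)) (a + int j))"

definition iterate_coeff ::
  "(int, 'v, 'v, 'y) vertex_space_scheme \<Rightarrow> ('i, 'v, 'w, 'z) vertex_space_scheme \<Rightarrow>
     'v \<Rightarrow> 'v \<Rightarrow> 'w \<Rightarrow> int \<Rightarrow> int \<Rightarrow> 'w" where
  "iterate_coeff V W u1 u2 w a b = Yop W (Yop V u1 u2 a) w b"

definition mult_binomial_power ::
  "('i, 'v, 'w, 'z) vertex_space_scheme \<Rightarrow> nat \<Rightarrow> (int \<Rightarrow> int \<Rightarrow> 'w) \<Rightarrow> int \<Rightarrow> int \<Rightarrow> 'w" where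
  "mult_binomial_power W p F a b =
     (\<Oplus>\<^bsub>W\<^esub>i\<in>{..p}. of_nat (p choose i) \<odot>\<^bsub>W\<^esub> F (a - int (p - i)) (b - int i))"

definition weak_associativity ::
  "(int, 'v, 'v, 'y) vertex_space_scheme \<Rightarrow> ('i, 'v, 'w, 'z) vertex_space_scheme \<Rightarrow> bool" where
  "weak_associativity V W \<longleftrightarrow>
     (\<forall>u1\<in>carrier V. \<forall>w\<in>carrier W. \<exists>p::nat. \<forall>u2\<in>carrier V.
        mult_binomial_power W p (product_coeff W u1 u2 w) =
        mult_binomial_power W p (iterate_coeff V W u1 u2 w))"

text \<open>\<open>D\<^sub>V v\<close>, the constant term of \<open>d/dx Y(v,x)\<one>\<close>.\<close>

definition Dop :: "'v vertex_algebra \<Rightarrow> 'v \<Rightarrow> 'v" where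
  "Dop V v = Yop V v (vac V) 1"

definition dV :: "'v vertex_algebra \<Rightarrow> 'v \<Rightarrow> 'v" where
  "dV V = diag_op V of_int"

definition dW :: "('v, 'w) left_mod \<Rightarrow> 'w \<Rightarrow> 'w" where
  "dW W = diag_op W (\<lambda>m. m)"

locale mosva =
  fixes V :: "'v vertex_algebra" (structure)
  assumes graded: "graded_space V"
    and vertex_map: "vertex_map V V"
    and vac_closed: "vac V \<in> carrier V"
    and lower_bound: "\<exists>n0. \<forall>n<n0. grade V n = {\<zero>}"
    and d_bracket: "\<And>v u n. v \<in> carrier V \<Longrightarrow> u \<in> carrier V \<Longrightarrow>
      dV V (Yop V v u n) \<ominus> Yop V v (dV V u) n = of_int n \<odot> Yop V v u n \<oplus> Yop V (dV V v) u n"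
    and identity: "\<And>u n. u \<in> carrier V \<Longrightarrow> Yop V (vac V) u n = (if n = 0 then u else \<zero>)"
    and creation_regular: "\<And>u n. u \<in> carrier V \<Longrightarrow> n < 0 \<Longrightarrow> Yop V u (vac V) n = \<zero>"
    and creation: "\<And>u. u \<in> carrier V \<Longrightarrow> Yop V u (vac V) 0 = u"
    and D_derivative: "\<And>v u n. v \<in> carrier V \<Longrightarrow> u \<in> carrier V \<Longrightarrow>
      of_int (n + 1) \<odot> Yop V v u (n + 1) = Yop V (Dop V v) u n"
    and D_bracket: "\<And>v u n. v \<in> carrier V \<Longrightarrow> u \<in> carrier V \<Longrightarrow>
      of_int (n + 1) \<odot> Yop V v u (n + 1) = Dop V (Yop V v u n) \<ominus> Yop V v (Dop V u) n"
    and weak_assoc: "weak_associativity V V"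

locale left_module =
  fixes V :: "'v vertex_algebra" and W :: "('v, 'w) left_mod" (structure)
  assumes graded: "graded_space W"
    and vertex_map: "vertex_map V W"
    and lower_bound: "\<exists>r::real. \<forall>m. Re m < r \<longrightarrow> grade W m = {\<zero>}"
    and d_bracket: "\<And>u w n. u \<in> carrier V \<Longrightarrow> w \<in> carrier W \<Longrightarrow>
      dW W (Yop W u w n) \<ominus> Yop W u (dW W w) n = Yop W (dV V u) w n \<oplus> of_int n \<odot> Yop W u w n"
    and identity: "\<And>w n. w \<in> carrier W \<Longrightarrow> Yop W (vac V) w n = (if n = 0 then w else \<zero>)"
    and D_derivative: "\<And>u w n. u \<in> carrier V \<Longrightarrow> w \<in> carrier W \<Longrightarrow>
      of_int (n + 1) \<odot> Yop W u w (n + 1) = Yop W (Dop V u) w n"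
    and weak_assoc: "weak_associativity V W"

text \<open>A submodule is in particular a graded subspace, so that \<open>d\<^sub>W\<close> restricts to it.\<close>

definition vsubmodule :: "'v vertex_algebra \<Rightarrow> ('v, 'w) left_mod \<Rightarrow> 'w set \<Rightarrow> bool" where
  "vsubmodule V W T \<longleftrightarrow>
     submodule T CC W \<and>
     (\<forall>v\<in>carrier V. \<forall>t\<in>T. \<forall>n. Yop W v t n \<in> T) \<and>
     (\<forall>t\<in>T. \<forall>m. comps W t m \<in> T)"

definition sub_mod :: "('v, 'w) left_mod \<Rightarrow> 'w set \<Rightarrow> ('v, 'w) left_mod" where
  "sub_mod W T = W\<lparr>carrier := T, grade := \<lambda>m. grade W m \<inter> T\<rparr>"

text \<open>
  \<open>W/T\<close> as a space of cosets.  In \<open>smult\<close> and \<open>Yop\<close> the union is over representatives, all of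
  which give the same coset.
\<close>

definition quot_mod :: "('v, 'w) left_mod \<Rightarrow> 'w set \<Rightarrow> ('v, 'w set) left_mod" where
  "quot_mod W T =
     \<lparr>carrier = a_rcosets\<^bsub>W\<^esub> T, mult = undefined, one = undefined, zero = T, add = set_add W,
      smult = \<lambda>a X. \<Union>x\<in>X. T +>\<^bsub>W\<^esub> (a \<odot>\<^bsub>W\<^esub> x),
      grade = \<lambda>m. (\<lambda>w. T +>\<^bsub>W\<^esub> w) ` grade W m,
      Yop = \<lambda>v X n. \<Union>x\<in>X. T +>\<^bsub>W\<^esub> Yop W v x n\<rparr>"


section \<open>Graded dual, algebraic completion and rational maps into it\<close>

text \<open>
  \<open>W' = \<Coprod>\<^sub>m W\<^sub>[\<^sub>m\<^sub>]\<^sup>*\<close> consists of families of functionals, of which only the values on the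
  respective \<open>grade W m\<close> matter; \<open>\<Prod>\<^sub>m W\<^sub>[\<^sub>m\<^sub>]\<close> consists of families of vectors, and \<open>W\<close> embeds in it
  by \<open>comps W\<close>.
\<close>

definition dual_supp :: "('v, 'w) left_mod \<Rightarrow> (complex \<Rightarrow> 'w \<Rightarrow> complex) \<Rightarrow> complex set" where
  "dual_supp W w' = {m. \<exists>x\<in>grade W m. w' m x \<noteq> 0}"

definition graded_dual :: "('v, 'w) left_mod \<Rightarrow> (complex \<Rightarrow> 'w \<Rightarrow> complex) set" where
  "graded_dual W = {w'.
     (\<forall>m. \<forall>x\<in>grade W m. \<forall>y\<in>grade W m. w' m (x \<oplus>\<^bsub>W\<^esub> y) = w' m x + w' m y) \<and>
     (\<forall>m a. \<forall>x\<in>grade W m. w' m (a \<odot>\<^bsub>W\<^esub> x) = a * w' m x) \<and>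
     finite (dual_supp W w')}"

definition completion :: "('v, 'w) left_mod \<Rightarrow> (complex \<Rightarrow> 'w) set" where
  "completion W = {f. \<forall>m. f m \<in> grade W m}"

definition pairing ::
  "('v, 'w) left_mod \<Rightarrow> (complex \<Rightarrow> 'w \<Rightarrow> complex) \<Rightarrow> (complex \<Rightarrow> 'w) \<Rightarrow> complex" where
  "pairing W w' f = (\<Sum>m\<in>dual_supp W w'. w' m (f m))"

text \<open>Maps on \<open>\<complex>\<^sup>\<times>\<close> are total functions whose value at \<open>0\<close> is ignored.\<close>

definition hat_space :: "('v, 'w) left_mod \<Rightarrow> (complex \<Rightarrow> complex \<Rightarrow> 'w) set" where
  "hat_space W = {f.
     (\<forall>\<zeta>. \<zeta> \<noteq> 0 \<longrightarrow> f \<zeta> \<in> completion W) \<and>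
     (\<forall>w'\<in>graded_dual W. \<exists>(q::complex poly) (b::nat). \<forall>\<zeta>. \<zeta> \<noteq> 0 \<longrightarrow>
        pairing W w' (f \<zeta>) = poly q \<zeta> / \<zeta> ^ b) \<and>
     (\<exists>(p::int) (g :: nat \<Rightarrow> 'w). (\<forall>n. g n \<in> carrier W) \<and>
        (\<forall>w'\<in>graded_dual W.
           finite {n. pairing W w' (comps W (g n)) \<noteq> 0} \<and>
           (\<forall>\<zeta>. \<zeta> \<noteq> 0 \<longrightarrow>
              \<zeta> powi p * pairing W w' (f \<zeta>) =
              (\<Sum>n | pairing W w' (comps W (g n)) \<noteq> 0. pairing W w' (comps W (g n)) * \<zeta> ^ n))))}"

text \<open>
  The formal Laurent series \<open>\<Sum>\<^sub>n c n \<zeta>\<^sup>n = \<zeta>\<^sup>-\<^sup>p g(\<zeta>)\<close> of an element of \<open>hat_space W\<close>; since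
  \<open>W'\<close> separates points of \<open>W\<close>, it is uniquely determined by \<open>f\<close>.
\<close>

definition laurent_series ::
  "('v, 'w) left_mod \<Rightarrow> (complex \<Rightarrow> complex \<Rightarrow> 'w) \<Rightarrow> (int \<Rightarrow> 'w) \<Rightarrow> bool" where
  "laurent_series W f c \<longleftrightarrow>
     (\<forall>n. c n \<in> carrier W) \<and> (\<exists>n0. \<forall>n<n0. c n = \<zero>\<^bsub>W\<^esub>) \<and>
     (\<forall>w'\<in>graded_dual W.
        finite {n. pairing W w' (comps W (c n)) \<noteq> 0} \<and>
        (\<forall>\<zeta>. \<zeta> \<noteq> 0 \<longrightarrow>
           pairing W w' (f \<zeta>) =
           (\<Sum>n | pairing W w' (comps W (c n)) \<noteq> 0. pairing W w' (comps W (c n)) * \<zeta> powi n)))"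

definition Hom_hat ::
  "('v, 'w1) left_mod \<Rightarrow> ('v, 'w2) left_mod \<Rightarrow> ('w1 \<Rightarrow> complex \<Rightarrow> complex \<Rightarrow> 'w2) set" where
  "Hom_hat W1 W2 = {\<phi>.
     (\<forall>w\<in>carrier W1. \<phi> w \<in> hat_space W2) \<and>
     (\<forall>w\<in>carrier W1. \<forall>w'\<in>carrier W1. \<forall>\<zeta> m. \<zeta> \<noteq> 0 \<longrightarrow>
        \<phi> (w \<oplus>\<^bsub>W1\<^esub> w') \<zeta> m = \<phi> w \<zeta> m \<oplus>\<^bsub>W2\<^esub> \<phi> w' \<zeta> m) \<and>
     (\<forall>a. \<forall>w\<in>carrier W1. \<forall>\<zeta> m. \<zeta> \<noteq> 0 \<longrightarrow>
        \<phi> (a \<odot>\<^bsub>W1\<^esub> w) \<zeta> m = a \<odot>\<^bsub>W2\<^esub> \<phi> w \<zeta> m)}"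


section \<open>The spaces \<open>\<H>\<^sub>N(W\<^sub>1,W\<^sub>2)\<close>\<close>

text \<open>
  \<open>a\<^sup>m\<close> is taken with the principal logarithm; the condition forces the weights it relates
  to differ by integers, so any other branch gives the same condition.
\<close>

definition d_conjugation ::
  "('v, 'w1) left_mod \<Rightarrow> ('v, 'w2) left_mod \<Rightarrow> ('w1 \<Rightarrow> complex \<Rightarrow> complex \<Rightarrow> 'w2) \<Rightarrow> int \<Rightarrow> bool" where
  "d_conjugation W1 W2 \<phi> n \<longleftrightarrow>
     (\<forall>a \<zeta>. \<forall>w\<in>carrier W1. \<forall>m. a \<noteq> 0 \<longrightarrow> \<zeta> \<noteq> 0 \<longrightarrow>
        (a powr m) \<odot>\<^bsub>W2\<^esub> \<phi> w \<zeta> m =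
        (a powi n) \<odot>\<^bsub>W2\<^esub> \<phi> (diag_op W1 (\<lambda>h. a powr h) w) (a * \<zeta>) m)"

text \<open>
  Functions of \<open>z\<^sub>1,\<dots>,z\<^sub>k\<^sub>+\<^sub>l,\<zeta>\<close> take a point \<open>x :: nat \<Rightarrow> complex\<close> with \<open>x i = z\<^sub>i\<^sub>+\<^sub>1\<close> for
  \<open>i < k + l\<close> and \<open>x (k + l) = \<zeta>\<close>; the elements \<open>v\<^sub>i\<^sub>+\<^sub>1\<close> are likewise \<open>v i\<close>.
  Exponents are extensional functions on \<open>{..k + l}\<close>.
\<close>

abbreviation exponents :: "nat \<Rightarrow> (nat \<Rightarrow> 'a) set" where
  "exponents n \<equiv> {..n} \<rightarrow>\<^sub>E UNIV"

definition poly_value :: "nat \<Rightarrow> ((nat \<Rightarrow> nat) \<Rightarrow> complex) \<Rightarrow> (nat \<Rightarrow> complex) \<Rightarrow> complex" where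
  "poly_value n q x = (\<Sum>a | a \<in> exponents n \<and> q a \<noteq> 0. q a * (\<Prod>i\<le>n. x i ^ a i))"

definition configurations :: "nat \<Rightarrow> (nat \<Rightarrow> complex) set" where
  "configurations n = {x. (\<forall>i\<le>n. x i \<noteq> 0) \<and> inj_on x {..n}}"

text \<open>Rational functions with poles only at \<open>x\<^sub>i = 0\<close> and \<open>x\<^sub>i = x\<^sub>j\<close>.\<close>

definition rational_on_configurations :: "nat \<Rightarrow> ((nat \<Rightarrow> complex) \<Rightarrow> complex) \<Rightarrow> bool" where
  "rational_on_configurations n f \<longleftrightarrow>
     (\<exists>(M::nat) q. finite {a \<in> exponents n. q a \<noteq> 0} \<and>
        (\<forall>x\<in>configurations n.
           (\<Prod>i\<le>n. x i) ^ M * (\<Prod>j\<le>n. \<Prod>i<j. x i - x j) ^ M * f x = poly_value n q x))"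

definition decreasing_region :: "nat list \<Rightarrow> (nat \<Rightarrow> complex) \<Rightarrow> bool" where
  "decreasing_region is x \<longleftrightarrow>
     sorted_wrt (\<lambda>i j. norm (x i) > norm (x j)) is \<and> (\<forall>i\<in>set is. norm (x i) > 0)"

text \<open>
  The terms of \<open>\<langle>w', Y(v\<^sub>1,z\<^sub>1)\<cdots>Y(v\<^sub>k,z\<^sub>k) \<phi>(\<zeta>) Y(v\<^sub>k\<^sub>+\<^sub>1,z\<^sub>k\<^sub>+\<^sub>1)\<cdots>Y(v\<^sub>k\<^sub>+\<^sub>l,z\<^sub>k\<^sub>+\<^sub>l) w\<rangle>\<close>
  as a Laurent series in all variables, \<open>\<Phi> u n\<close> being the coefficient of \<open>\<zeta>\<^sup>n\<close> in \<open>\<phi>(\<zeta>)u\<close>.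
\<close>

definition corr_term ::
  "('v, 'w1) left_mod \<Rightarrow> ('v, 'w2) left_mod \<Rightarrow> ('w1 \<Rightarrow> int \<Rightarrow> 'w2) \<Rightarrow> nat \<Rightarrow> nat \<Rightarrow> (nat \<Rightarrow> 'v) \<Rightarrow>
     'w1 \<Rightarrow> (complex \<Rightarrow> 'w2 \<Rightarrow> complex) \<Rightarrow> (nat \<Rightarrow> complex) \<Rightarrow> (nat \<Rightarrow> int) \<Rightarrow> complex" where
  "corr_term W1 W2 \<Phi> k l v w w' x e =
     pairing W2 w' (comps W2
       (foldr (\<lambda>i u. Yop W2 (v i) u (e i)) [0..<k]
         (\<Phi> (foldr (\<lambda>i u. Yop W1 (v i) u (e i)) [k..<k + l] w) (e (k + l)))))
     * (\<Prod>i\<le>k + l. x i powi e i)"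

definition is_correlation ::
  "('v, 'w1) left_mod \<Rightarrow> ('v, 'w2) left_mod \<Rightarrow> ('w1 \<Rightarrow> int \<Rightarrow> 'w2) \<Rightarrow> nat \<Rightarrow> nat \<Rightarrow> (nat \<Rightarrow> 'v) \<Rightarrow>
     'w1 \<Rightarrow> (complex \<Rightarrow> 'w2 \<Rightarrow> complex) \<Rightarrow> ((nat \<Rightarrow> complex) \<Rightarrow> complex) \<Rightarrow> bool" where
  "is_correlation W1 W2 \<Phi> k l v w w' f \<longleftrightarrow>
     rational_on_configurations (k + l) f \<and>
     (\<forall>x. decreasing_region ([0..<k] @ [k + l] @ [k..<k + l]) x \<longrightarrow>
        (\<lambda>e. norm (corr_term W1 W2 \<Phi> k l v w w' x e)) summable_on exponents (k + l) \<and>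
        (corr_term W1 W2 \<Phi> k l v w w' x has_sum f x) (exponents (k + l)))"

text \<open>
  The dependence of the pole orders on the data is expressed by the position of their quantifiers,
  for the given \<open>\<phi>\<close>.
\<close>

definition composability ::
  "'v vertex_algebra \<Rightarrow> ('v, 'w1) left_mod \<Rightarrow> ('v, 'w2) left_mod \<Rightarrow> ('w1 \<Rightarrow> int \<Rightarrow> 'w2) \<Rightarrow> bool" where
  "composability V W1 W2 \<Phi> \<longleftrightarrow>
     (\<exists>(r :: 'v \<Rightarrow> 'w1 \<Rightarrow> nat) (m :: 'w1 \<Rightarrow> nat) (p :: 'v \<Rightarrow> 'v \<Rightarrow> nat) (s :: 'v \<Rightarrow> nat).
      \<forall>k l v. \<forall>w\<in>carrier W1. (\<forall>i<k + l. v i \<in> carrier V) \<longrightarrow>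
        (\<exists>g :: (nat \<Rightarrow> nat) \<Rightarrow> 'w2. (\<forall>a\<in>exponents (k + l). g a \<in> carrier W2) \<and>
          (\<forall>w'\<in>graded_dual W2. \<exists>f. is_correlation W1 W2 \<Phi> k l v w w' f \<and>
             finite {a \<in> exponents (k + l). pairing W2 w' (comps W2 (g a)) \<noteq> 0} \<and>
             (\<forall>x\<in>configurations (k + l).
                x (k + l) ^ m w * (\<Prod>i<k + l. x i ^ r (v i) w) *
                (\<Prod>j<k + l. \<Prod>i<j. (x i - x j) ^ p (v i) (v j)) *
                (\<Prod>i<k + l. (x i - x (k + l)) ^ s (v i)) * f x =
                poly_value (k + l) (\<lambda>a. pairing W2 w' (comps W2 (g a))) x))))"

text \<open>
  For \<open>l \<ge> 1\<close> put \<open>t = k + l - 1\<close>, so \<open>x t = z\<^sub>k\<^sub>+\<^sub>l\<close>.  The expansion variables are \<open>x t\<close> itself and the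
  differences with it; \<open>shifted t x\<close> lists them with \<open>x t\<close> kept in position \<open>t\<close>.  In a family \<open>C\<close> of
  Laurent coefficients, position \<open>t\<close> of the exponent is thus that of \<open>z\<^sub>k\<^sub>+\<^sub>l\<close>.  Such an expansion of
  \<open>f\<close> exists and is unique.
\<close>

definition shifted :: "nat \<Rightarrow> (nat \<Rightarrow> complex) \<Rightarrow> nat \<Rightarrow> complex" where
  "shifted t x i = (if i = t then x t else x i - x t)"

definition is_shifted_expansion ::
  "nat \<Rightarrow> nat \<Rightarrow> ((nat \<Rightarrow> complex) \<Rightarrow> complex) \<Rightarrow> ((nat \<Rightarrow> int) \<Rightarrow> complex) \<Rightarrow> bool" where
  "is_shifted_expansion k l f C \<longleftrightarrow>
     (let t = k + l - 1 in
      (\<forall>e\<in>exponents (k + l). finite {b. C (e(t := b)) \<noteq> 0}) \<and>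
      (\<forall>x. decreasing_region ([t] @ [0..<k] @ [k + l] @ [k..<t]) (shifted t x) \<longrightarrow>
         (\<lambda>e. norm (C e * (\<Prod>i\<le>k + l. shifted t x i powi e i))) summable_on exponents (k + l) \<and>
         ((\<lambda>e. C e * (\<Prod>i\<le>k + l. shifted t x i powi e i)) has_sum f x) (exponents (k + l))))"

definition weight_degree ::
  "int \<Rightarrow> 'v vertex_algebra \<Rightarrow> ('v, 'w1) left_mod \<Rightarrow> ('v, 'w2) left_mod \<Rightarrow> ('w1 \<Rightarrow> int \<Rightarrow> 'w2) \<Rightarrow>
     int \<Rightarrow> bool" where
  "weight_degree N V W1 W2 \<Phi> n \<longleftrightarrow>
     (\<forall>k l v h f. \<forall>w\<in>carrier W1. \<forall>w'\<in>graded_dual W2.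
        l \<ge> 1 \<longrightarrow> (\<forall>i<k + l. v i \<in> grade V (h i)) \<longrightarrow> is_correlation W1 W2 \<Phi> k l v w w' f \<longrightarrow>
        (\<exists>C. is_shifted_expansion k l f C \<and>
           (\<forall>e\<in>exponents (k + l). C e \<noteq> 0 \<longrightarrow>
              (\<Sum>i\<in>{..k + l} - {k + l - 1}. e i) \<ge> N - (\<Sum>i<k + l. h i) - n)))"

definition H_generator ::
  "int \<Rightarrow> 'v vertex_algebra \<Rightarrow> ('v, 'w1) left_mod \<Rightarrow> ('v, 'w2) left_mod \<Rightarrow>
     ('w1 \<Rightarrow> complex \<Rightarrow> complex \<Rightarrow> 'w2) \<Rightarrow> bool" where
  "H_generator N V W1 W2 \<phi> \<longleftrightarrow>
     \<phi> \<in> Hom_hat W1 W2 \<and>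
     (\<exists>n \<Phi>. (\<forall>w\<in>carrier W1. laurent_series W2 (\<phi> w) (\<Phi> w)) \<and>
        d_conjugation W1 W2 \<phi> n \<and> composability V W1 W2 \<Phi> \<and> weight_degree N V W1 W2 \<Phi> n)"

text \<open>The span is taken among maps defined on \<open>carrier W1\<close> and \<open>\<complex>\<^sup>\<times>\<close>, hence the guards.\<close>

definition H_space ::
  "int \<Rightarrow> 'v vertex_algebra \<Rightarrow> ('v, 'w1) left_mod \<Rightarrow> ('v, 'w2) left_mod \<Rightarrow>
     ('w1 \<Rightarrow> complex \<Rightarrow> complex \<Rightarrow> 'w2) set" where
  "H_space N V W1 W2 = {\<phi>.
     \<exists>(r::nat) (\<psi> :: nat \<Rightarrow> 'w1 \<Rightarrow> complex \<Rightarrow> complex \<Rightarrow> 'w2) c.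
       (\<forall>i<r. H_generator N V W1 W2 (\<psi> i)) \<and>
       (\<forall>w\<in>carrier W1. \<forall>\<zeta> m. \<zeta> \<noteq> 0 \<longrightarrow>
          \<phi> w \<zeta> m = (\<Oplus>\<^bsub>W2\<^esub>i\<in>{..<r}. c i \<odot>\<^bsub>W2\<^esub> \<psi> i w \<zeta> m))}"


section \<open>The category \<open>\<C>\<^sub>N\<close>\<close>

definition direct_sum :: "('v, 'w) left_mod \<Rightarrow> 'w set \<Rightarrow> 'w set \<Rightarrow> bool" where
  "direct_sum W A B \<longleftrightarrow>
     submodule A CC W \<and> submodule B CC W \<and> A \<inter> B = {\<zero>\<^bsub>W\<^esub>} \<and> A <+>\<^bsub>W\<^esub> B = carrier W"

text \<open>\<open>proj W A B\<close> is the projection onto \<open>A\<close> along \<open>B\<close>.\<close>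

definition proj :: "('v, 'w) left_mod \<Rightarrow> 'w set \<Rightarrow> 'w set \<Rightarrow> 'w \<Rightarrow> 'w" where
  "proj W A B w = (THE a. a \<in> A \<and> (\<exists>b\<in>B. w = a \<oplus>\<^bsub>W\<^esub> b))"

text \<open>
  The module structure on a complement \<open>A\<close> of a submodule \<open>B\<close>.  \<open>A\<close> is only required to be a vector
  subspace; its grading is the one with \<open>d\<^sub>A = \<pi>\<^sub>A d\<^sub>W\<close>, equal to \<open>grade W m \<inter> A\<close> when \<open>A\<close> is
  a graded subspace.  With it \<open>\<pi>\<^sub>A\<close> induces an isomorphism \<open>W/B \<cong> A\<close> of modules.
\<close>

definition compl_mod :: "('v, 'w) left_mod \<Rightarrow> 'w set \<Rightarrow> 'w set \<Rightarrow> ('v, 'w) left_mod" where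
  "compl_mod W A B = W\<lparr>carrier := A,
     grade := \<lambda>m. proj W A B ` grade W m,
     Yop := \<lambda>v w n. proj W A B (Yop W v w n)\<rparr>"

text \<open>
  Objects of \<open>\<C>\<^sub>N\<close>.  That \<open>\<pi>\<^sub>B Y(v,x) \<pi>\<^sub>A\<close> lies in \<open>\<H>\<^sub>N\<close> means that this formal series is the
  Laurent series of a map in \<open>\<H>\<^sub>N\<close>.  The category is full in the category of left \<open>V\<close>-modules, so it is
  determined by its objects.
\<close>

definition in_category_C :: "int \<Rightarrow> 'v vertex_algebra \<Rightarrow> ('v, 'w) left_mod \<Rightarrow> bool" where
  "in_category_C N V W \<longleftrightarrow>
     left_module V W \<and>
     (\<forall>B. vsubmodule V W B \<longrightarrow>
        (\<exists>A. direct_sum W A B \<and>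
           (\<forall>v\<in>carrier V. \<exists>\<phi>\<in>H_space N V (compl_mod W A B) (sub_mod W B).
              \<forall>w\<in>A. laurent_series (sub_mod W B) (\<phi> w) (\<lambda>n. proj W B A (Yop W v w n)))))"

end

theory Submission
  imports Defs
begin

text \<open>
  The spaces \<open>\<H>\<^sub>N(W\<^sub>1,W\<^sub>2)\<close> are functorial: a homomorphism \<open>W\<^sub>1' \<rightarrow> W\<^sub>1\<close> and a homomorphism
  \<open>W\<^sub>2 \<rightarrow> W\<^sub>2'\<close> carry \<open>\<H>\<^sub>N(W\<^sub>1,W\<^sub>2)\<close> into \<open>\<H>\<^sub>N(W\<^sub>1',W\<^sub>2')\<close>, since the correlation functions of the
  composite are those of \<open>\<phi>\<close> at the image vector and at the pulled back functional.  A submodule \<open>B\<close>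
  of \<open>T\<close> is a submodule of \<open>W\<close>; if \<open>A\<close> is a complement of \<open>B\<close> in \<open>W\<close> satisfying the condition on
  \<open>\<H>\<^sub>N\<close>, then so is \<open>A \<inter> T\<close> in \<open>T\<close>, by restriction along \<open>A \<inter> T \<subseteq> A\<close>.  A submodule of \<open>W/T\<close> has the form \<open>B/T\<close> with \<open>T \<subseteq> B\<close>; if
  \<open>A\<close> is such a complement of \<open>B\<close>, then \<open>A\<close> maps isomorphically onto a complement of \<open>B/T\<close>, and one
  composes with the inverse of this isomorphism and with \<open>B \<rightarrow> B/T\<close>.
\<close>

section \<open>Linear and graded maps\<close>

lemma CC_simps [simp]:
  "carrier CC = UNIV" "a \<otimes>\<^bsub>CC\<^esub> b = a * b" "\<one>\<^bsub>CC\<^esub> = 1" "\<zero>\<^bsub>CC\<^esub> = 0" "a \<oplus>\<^bsub>CC\<^esub> b = a + b"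
  by (simp_all add: CC_def)

lemma cring_CC: "cring CC"
proof (rule cringI)
  show "abelian_group CC"
  proof (rule abelian_groupI)
    fix x assume "x \<in> carrier CC"
    show "\<exists>y\<in>carrier CC. y \<oplus>\<^bsub>CC\<^esub> x = \<zero>\<^bsub>CC\<^esub>"
      by (rule bexI[of _ "- x"]) simp_all
  qed simp_all
  show "comm_monoid CC"
    by (rule comm_monoidI) simp_all
qed (simp add: distrib_right)

text \<open>Both \<open>sub_mod\<close> and \<open>compl_mod\<close> keep the linear operations of
  \<open>W\<close> but change other fields of the record, so \<open>M'\<close> is any structure
  sharing addition, zero and scalar multiplication with \<open>M\<close>.\<close>

lemma submodule_module:
  fixes M :: "(complex, 'a, 'z) module_scheme"
  assumes "module CC M" "submodule H CC M" "carrier M' = H" "add M' = add M" "zero M' = zero M"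
    "smult M' = smult M"
  shows "module CC M'"
proof -
  interpret M: module CC M by fact
  note H = M.submoduleE[OF assms(2)]
  have sub: "x \<in> carrier M" if "x \<in> H" for x using that H by blast
  have zero: "\<zero>\<^bsub>M\<^esub> \<in> H"
    using assms(2) by (auto simp: submodule_def dest: subgroup.one_closed)
  show ?thesis
  proof (rule moduleI)
    show "abelian_group M'"
    proof (rule abelian_groupI)
      fix x assume "x \<in> carrier M'"
      then show "\<exists>y\<in>carrier M'. y \<oplus>\<^bsub>M'\<^esub> x = \<zero>\<^bsub>M'\<^esub>"
        using H(3)[of x] sub[of x] assms(3-) by (intro bexI[of _ "\<ominus>\<^bsub>M\<^esub> x"]) (auto simp: M.l_neg)
    qed (use assms(3-) H sub zero in \<open>auto simp: M.a_assoc intro: M.a_comm\<close>)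
  qed (use assms(3-) H sub zero M.smult_l_distr M.smult_r_distr M.smult_assoc1 M.smult_one
        in \<open>auto simp: cring_CC\<close>)
qed

text \<open>That both sides are modules belongs to the locale, so proving a projection or a coset
  map linear also delivers the module structure of its target.\<close>

locale linear_map =
  fixes M :: "(complex, 'a, 'y) module_scheme" and M' :: "(complex, 'b, 'z) module_scheme"
    and f :: "'a \<Rightarrow> 'b"
  assumes dom: "module CC M" and cod: "module CC M'"
    and closed: "x \<in> carrier M \<Longrightarrow> f x \<in> carrier M'"
    and add: "x \<in> carrier M \<Longrightarrow> y \<in> carrier M \<Longrightarrow> f (x \<oplus>\<^bsub>M\<^esub> y) = f x \<oplus>\<^bsub>M'\<^esub> f y"
    and smult: "x \<in> carrier M \<Longrightarrow> f (a \<odot>\<^bsub>M\<^esub> x) = a \<odot>\<^bsub>M'\<^esub> f x"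
begin

sublocale D: module CC M by (rule dom)
sublocale C: module CC M' by (rule cod)

lemma zero: "f \<zero>\<^bsub>M\<^esub> = \<zero>\<^bsub>M'\<^esub>"
  using smult[of "\<zero>\<^bsub>M\<^esub>" 0] D.smult_l_null[of "\<zero>\<^bsub>M\<^esub>"] C.smult_l_null[of "f \<zero>\<^bsub>M\<^esub>"] closed by simp

lemma neg: "x \<in> carrier M \<Longrightarrow> f (\<ominus>\<^bsub>M\<^esub> x) = \<ominus>\<^bsub>M'\<^esub> f x"
  by (metis C.minus_equality D.a_inv_closed D.l_neg add closed zero)

lemma minus: "x \<in> carrier M \<Longrightarrow> y \<in> carrier M \<Longrightarrow> f (x \<ominus>\<^bsub>M\<^esub> y) = f x \<ominus>\<^bsub>M'\<^esub> f y"
  by (simp add: a_minus_def add neg)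

lemma finsum:
  assumes "g \<in> A \<rightarrow> carrier M"
  shows "f (finsum M g A) = finsum M' (\<lambda>i. f (g i)) A"
proof (cases "finite A")
  case True
  then show ?thesis using assms
    by (induct A) (auto simp: zero D.finsum_insert C.finsum_insert add closed Pi_def)
next
  case False
  \<comment> \<open>An infinite \<open>finsum\<close> has the default value zero, and
    \<open>f\<close> preserves zero.\<close>
  then show ?thesis by (simp add: D.finsum_infinite C.finsum_infinite zero)
qed

end

text \<open>Decompositions, \<open>diag_op\<close> and \<open>product_coeff\<close> sum over exact
  supports. These shrink when terms cancel or a map kills them, so sums over different index sets
  have to be compared.\<close>

lemma (in abelian_monoid) finsum_support:
  assumes "finite A" "B \<subseteq> A" "g \<in> A \<rightarrow> carrier G" "\<And>i. i \<in> A - B \<Longrightarrow> g i = \<zero>"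
  shows "finsum G g A = finsum G g B"
  using assms by (intro add.finprod_mono_neutral_cong_right) auto

text \<open>Stated over an abelian monoid so that it can be applied while \<open>W\<close> is still
  being shown to be graded. The finite set \<open>S\<close> may exceed the support of
  \<open>c\<close>.\<close>

lemma is_decompI:
  assumes "abelian_monoid W" "\<And>i. c i \<in> grade W i" "\<And>i. c i \<in> carrier W" "finite S"
    "\<And>i. i \<notin> S \<Longrightarrow> c i = \<zero>\<^bsub>W\<^esub>" "w = (\<Oplus>\<^bsub>W\<^esub>i\<in>S. c i)"
  shows "is_decomp W w c"
proof -
  interpret abelian_monoid W by fact
  have "{i. c i \<noteq> \<zero>\<^bsub>W\<^esub>} \<subseteq> S" using assms(5) by auto
  moreover from this have "finite {i. c i \<noteq> \<zero>\<^bsub>W\<^esub>}" using assms(4) finite_subset by blast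
  moreover have "(\<Oplus>\<^bsub>W\<^esub>i\<in>S. c i) = (\<Oplus>\<^bsub>W\<^esub>i\<in>{i. c i \<noteq> \<zero>\<^bsub>W\<^esub>}. c i)"
    using assms(3,4) calculation by (intro finsum_support) auto
  ultimately show ?thesis using assms by (simp add: is_decomp_def)
qed

lemma graded_space_module: "graded_space W \<Longrightarrow> module CC W"
  by (simp add: graded_space_def)

section \<open>Homogeneous components and diagonal operators\<close>

locale graded = fixes W :: "('i, 'v, 'w, 'z) vertex_space_scheme" (structure)
  assumes graded: "graded_space W"
begin

sublocale module CC W using graded by (rule graded_space_module)

lemma submodule_grade: "submodule (grade W i) CC W"
  using graded by (simp add: graded_space_def)

lemma grade_closed: "x \<in> grade W i \<Longrightarrow> x \<in> carrier W"
  using submoduleE(1)[OF submodule_grade] by blast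

lemma zero_in_grade: "\<zero> \<in> grade W i"
  using submodule_grade[of i] by (auto simp: submodule_def dest: subgroup.one_closed)

lemma grade_add: "x \<in> grade W i \<Longrightarrow> y \<in> grade W i \<Longrightarrow> x \<oplus> y \<in> grade W i"
  using submoduleE(5)[OF submodule_grade] by blast

lemma grade_smult: "x \<in> grade W i \<Longrightarrow> a \<odot> x \<in> grade W i"
  using submoduleE(4)[OF submodule_grade] by simp

lemma decompI:
  assumes "\<And>i. c i \<in> grade W i" "finite S" "\<And>i. i \<notin> S \<Longrightarrow> c i = \<zero>" "w = (\<Oplus>i\<in>S. c i)"
  shows "is_decomp W w c"
  using assms grade_closed by (intro is_decompI[OF abelian_monoid_axioms, where S = S]) auto

lemma is_decomp_comps: "w \<in> carrier W \<Longrightarrow> is_decomp W w (comps W w)"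
  using graded unfolding graded_space_def comps_def by (metis theI')

lemma comps_eqI: "is_decomp W w c \<Longrightarrow> w \<in> carrier W \<Longrightarrow> comps W w = c"
  using graded is_decomp_comps unfolding graded_space_def by blast

lemma comps_in_grade: "w \<in> carrier W \<Longrightarrow> comps W w i \<in> grade W i"
  using is_decomp_comps by (simp add: is_decomp_def)

lemma comps_closed: "w \<in> carrier W \<Longrightarrow> comps W w i \<in> carrier W"
  by (rule grade_closed) (rule comps_in_grade)

lemma finite_comps: "w \<in> carrier W \<Longrightarrow> finite {i. comps W w i \<noteq> \<zero>}"
  using is_decomp_comps by (simp add: is_decomp_def)

lemma finsum_comps: "w \<in> carrier W \<Longrightarrow> (\<Oplus>i\<in>{i. comps W w i \<noteq> \<zero>}. comps W w i) = w"
  using is_decomp_comps by (simp add: is_decomp_def)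

lemma finsum_comps':
  assumes "w \<in> carrier W" "finite S" "{i. comps W w i \<noteq> \<zero>} \<subseteq> S"
  shows "(\<Oplus>i\<in>S. comps W w i) = w"
proof -
  have "(\<Oplus>i\<in>S. comps W w i) = (\<Oplus>i\<in>{i. comps W w i \<noteq> \<zero>}. comps W w i)"
    using assms by (intro finsum_support) (auto intro: comps_closed)
  then show ?thesis using finsum_comps[OF assms(1)] by simp
qed

lemma comps_homogeneous:
  assumes "w \<in> grade W m"
  shows "comps W w = (\<lambda>i. if i = m then w else \<zero>)"
proof (rule comps_eqI)
  show "is_decomp W w (\<lambda>i. if i = m then w else \<zero>)"
    using assms grade_closed[OF assms]
    by (intro decompI[of _ "{m}"]) (auto simp: zero_in_grade finsum_insert finsum_empty)
qed (rule grade_closed[OF assms])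

lemma comps_add:
  assumes "x \<in> carrier W" "y \<in> carrier W"
  shows "comps W (x \<oplus> y) i = comps W x i \<oplus> comps W y i"
proof -
  \<comment> \<open>A common finite index set for both vectors; cancellation may make the support of
    the sum smaller, which \<open>decompI\<close> allows.\<close>
  let ?S = "{i. comps W x i \<noteq> \<zero>} \<union> {i. comps W y i \<noteq> \<zero>}"
  have S: "finite ?S" using assms finite_comps by blast
  have "comps W (x \<oplus> y) = (\<lambda>i. comps W x i \<oplus> comps W y i)"
  proof (rule comps_eqI)
    show "is_decomp W (x \<oplus> y) (\<lambda>i. comps W x i \<oplus> comps W y i)"
    proof (rule decompI[OF _ S])
      have "(\<Oplus>i\<in>?S. comps W x i) = x" "(\<Oplus>i\<in>?S. comps W y i) = y"
        using assms S by (auto intro!: finsum_comps')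
      then show "x \<oplus> y = (\<Oplus>i\<in>?S. comps W x i \<oplus> comps W y i)"
        using finsum_addf[of "comps W x" ?S "comps W y"] assms by (simp add: comps_closed)
    qed (use assms in \<open>auto intro: grade_add comps_in_grade\<close>)
  qed (use assms in auto)
  then show ?thesis by simp
qed

lemma diag_op_closed: "w \<in> carrier W \<Longrightarrow> diag_op W s w \<in> carrier W"
  unfolding diag_op_def by (rule finsum_closed) (auto simp: comps_closed)

lemma comps_diag_op:
  assumes "w \<in> carrier W"
  shows "comps W (diag_op W s w) = (\<lambda>i. s i \<odot> comps W w i)"
proof (rule comps_eqI)
  show "is_decomp W (diag_op W s w) (\<lambda>i. s i \<odot> comps W w i)"
    using assms finite_comps
    by (intro decompI[of _ "{i. comps W w i \<noteq> \<zero>}"])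
      (auto simp: diag_op_def intro: grade_smult comps_in_grade)
qed (rule diag_op_closed[OF assms])

lemma diag_op_homogeneous: "w \<in> grade W m \<Longrightarrow> diag_op W s w = s m \<odot> w"
  using comps_homogeneous[of w m] grade_closed[of w m]
  by (cases "w = \<zero>") (simp_all add: diag_op_def finsum_insert finsum_empty)

lemma comps_smult:
  assumes "w \<in> carrier W"
  shows "comps W (a \<odot> w) i = a \<odot> comps W w i"
proof -
  \<comment> \<open>Scalar multiplication is the diagonal operator with constant eigenvalue, so its
    components are known from \<open>comps_diag_op\<close>.\<close>
  have "a \<odot> w = diag_op W (\<lambda>_. a) w"
    using assms finsum_smult_ldistr[of "{i. comps W w i \<noteq> \<zero>}" a "comps W w"]
    by (simp add: diag_op_def finsum_comps finite_comps comps_closed)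
  then show ?thesis using comps_diag_op[OF assms] by metis
qed

lemma graded_induct [consumes 1, case_names zero add homogeneous]:
  assumes "w \<in> carrier W" "P \<zero>"
    "\<And>x y. x \<in> carrier W \<Longrightarrow> y \<in> carrier W \<Longrightarrow> P x \<Longrightarrow> P y \<Longrightarrow> P (x \<oplus> y)"
    "\<And>x i. x \<in> grade W i \<Longrightarrow> P x"
  shows "P w"
proof -
  have "P (\<Oplus>i\<in>S. comps W w i)" if "finite S" for S
    using that
  proof (induct S)
    case (insert i S)
    then show ?case
      using assms(1) by (auto simp: comps_closed finsum_insert
          intro!: assms(3) assms(4)[OF comps_in_grade] finsum_closed)
  qed (simp add: assms(2))
  then show ?thesis using finsum_comps[OF assms(1)] finite_comps[OF assms(1)] by metis
qed

end

lemma (in module) smult_eq_zero: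
  assumes "a \<in> Units R" "x \<in> carrier M" "a \<odot>\<^bsub>M\<^esub> x = \<zero>\<^bsub>M\<^esub>"
  shows "x = \<zero>\<^bsub>M\<^esub>"
  using assms smult_assoc1[of "inv a" a x] R.Units_closed[OF assms(1)] by simp

text \<open>In degree \<open>i\<close> the eigenvalue equation says that \<open>i - a\<close>
  annihilates the component of \<open>w\<close>. For \<open>i \<noteq> a\<close> this scalar is
  invertible, so only the component of degree \<open>a\<close> survives.\<close>

lemma diag_op_eigenvector:
  fixes W :: "('v, 'w) left_mod" (structure)
  assumes "graded_space W" "w \<in> carrier W" "dW W w = a \<odot> w"
  shows "w \<in> grade W a"
proof -
  interpret graded W by unfold_locales fact
  have "comps W w i = \<zero>" if "i \<noteq> a" for i
  proof -
    let ?c = "comps W w i"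
    have c: "?c \<in> carrier W" using assms comps_closed by simp
    have "i \<odot> ?c = a \<odot> ?c"
      using comps_diag_op[OF assms(2), of "\<lambda>m. m"] comps_smult[OF assms(2), of a i] assms(3)
      by (metis dW_def)
    moreover have "i \<odot> ?c = (i - a) \<odot> ?c \<oplus> a \<odot> ?c"
      using smult_l_distr[of "i - a" a ?c] c by simp
    ultimately have "(i - a) \<odot> ?c = \<zero>" using c by simp
    moreover have "i - a \<in> Units CC" using that
      by (auto simp: Units_def intro!: exI[of _ "1 / (i - a)"])
    ultimately show ?thesis using smult_eq_zero c by blast
  qed
  then have "{i. comps W w i \<noteq> \<zero>} \<subseteq> {a}" by blast
  then have "w = comps W w a"
    using finsum_comps'[OF assms(2), of "{a}"] assms(2)
    by (simp add: finsum_insert finsum_empty comps_closed)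
  then show ?thesis using comps_in_grade[OF assms(2)] by metis
qed

section \<open>Degree-preserving linear maps\<close>

locale graded_map = linear_map W W' f
  for W :: "('i, 'v, 'a, 'y) vertex_space_scheme" and W' :: "('i, 'u, 'b, 'z) vertex_space_scheme"
    and f :: "'a \<Rightarrow> 'b" +
  assumes graded_dom: "graded_space W" and graded_cod: "graded_space W'"
    and grade: "x \<in> grade W i \<Longrightarrow> f x \<in> grade W' i"
begin

sublocale D: graded W by unfold_locales (rule graded_dom)
sublocale C: graded W' by unfold_locales (rule graded_cod)

lemma comps:
  assumes "w \<in> carrier W"
  shows "comps W' (f w) = (\<lambda>i. f (comps W w i))"
proof (rule C.comps_eqI)
  show "is_decomp W' (f w) (\<lambda>i. f (comps W w i))"
  proof (rule C.decompI[OF grade D.finite_comps[OF assms]])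
    show "f w = (\<Oplus>\<^bsub>W'\<^esub>i\<in>{i. comps W w i \<noteq> \<zero>\<^bsub>W\<^esub>}. f (comps W w i))"
      using finsum[of "comps W w" "{i. comps W w i \<noteq> \<zero>\<^bsub>W\<^esub>}"] assms
      by (simp add: D.comps_closed D.finsum_comps)
  qed (use assms in \<open>auto simp: zero D.comps_in_grade\<close>)
qed (rule closed[OF assms])

lemma diag_op:
  assumes "w \<in> carrier W"
  shows "f (diag_op W s w) = diag_op W' s (f w)"
proof -
  have "f (diag_op W s w) = (\<Oplus>\<^bsub>W'\<^esub>i\<in>{i. comps W w i \<noteq> \<zero>\<^bsub>W\<^esub>}. s i \<odot>\<^bsub>W'\<^esub> f (comps W w i))"
    using assms D.comps_closed by (simp add: diag_op_def finsum smult)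
  \<comment> \<open>The support of \<open>f w\<close> can be smaller than that of \<open>w\<close>;
    the surplus terms are zero.\<close>
  also have "\<dots> = diag_op W' s (f w)"
    unfolding diag_op_def comps[OF assms]
    using assms D.finite_comps D.comps_closed
    by (intro C.finsum_support) (auto simp: zero closed)
  finally show ?thesis .
qed

end

section \<open>Subspaces, complements and quotients\<close>

lemma (in linear_map) submodule_image:
  assumes "submodule H CC M"
  shows "submodule (f ` H) CC M'"
proof (rule C.submoduleI)
  note H = D.submoduleE[OF assms]
  have sub: "x \<in> carrier M" if "x \<in> H" for x using that H by blast
  show "f ` H \<subseteq> carrier M'" using sub closed by blast
  have "\<zero>\<^bsub>M\<^esub> \<in> H" using assms by (auto simp: submodule_def dest: subgroup.one_closed)
  then show "\<zero>\<^bsub>M'\<^esub> \<in> f ` H" using zero by (metis imageI)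
  show "\<ominus>\<^bsub>M'\<^esub> a \<in> f ` H" if "a \<in> f ` H" for a
    using that H(3) neg[OF sub] by (metis (no_types, lifting) image_iff)
  show "a \<oplus>\<^bsub>M'\<^esub> b \<in> f ` H" if "a \<in> f ` H" "b \<in> f ` H" for a b
    using that H(5) add[OF sub sub] by (metis (no_types, lifting) image_iff)
  show "a \<odot>\<^bsub>M'\<^esub> x \<in> f ` H" if "x \<in> f ` H" for a x
    using that H(4) smult[OF sub] by (metis (no_types, lifting) CC_simps(1) UNIV_I image_iff)
qed

lemma (in linear_map) submodule_vimage:
  assumes "submodule H CC M'"
  shows "submodule {x \<in> carrier M. f x \<in> H} CC M"
proof (rule D.submoduleI)
  note H = C.submoduleE[OF assms]
  have "\<zero>\<^bsub>M'\<^esub> \<in> H" using assms by (auto simp: submodule_def dest: subgroup.one_closed)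
  then show "\<zero>\<^bsub>M\<^esub> \<in> {x \<in> carrier M. f x \<in> H}" by (simp add: zero)
qed (use C.submoduleE[OF assms] in \<open>auto simp: neg add smult\<close>)

lemma (in module) smult_commute:
  assumes "a \<in> carrier R" "b \<in> carrier R" "x \<in> carrier M"
  shows "a \<odot>\<^bsub>M\<^esub> (b \<odot>\<^bsub>M\<^esub> x) = b \<odot>\<^bsub>M\<^esub> (a \<odot>\<^bsub>M\<^esub> x)"
  using assms smult_assoc1[of a b x] smult_assoc1[of b a x] R.m_comm[of a b] by simp

text \<open>Every module law holds for \<open>M'\<close> as the image under \<open>f\<close> of the
  law for \<open>M\<close>. This is how the space of cosets becomes a module.\<close>

lemma module_image:
  fixes M :: "(complex, 'a, 'y) module_scheme" and M' :: "(complex, 'b, 'z) module_scheme"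
  assumes "module CC M" and M': "carrier M' = f ` carrier M" "\<zero>\<^bsub>M'\<^esub> = f \<zero>\<^bsub>M\<^esub>"
    and add: "\<And>x y. x \<in> carrier M \<Longrightarrow> y \<in> carrier M \<Longrightarrow> f x \<oplus>\<^bsub>M'\<^esub> f y = f (x \<oplus>\<^bsub>M\<^esub> y)"
    and smult: "\<And>a x. x \<in> carrier M \<Longrightarrow> a \<odot>\<^bsub>M'\<^esub> f x = f (a \<odot>\<^bsub>M\<^esub> x)"
  shows "module CC M'"
proof -
  interpret module CC M by fact
  show ?thesis
  proof (rule moduleI)
    show "abelian_group M'"
    proof (rule abelian_groupI)
      fix x assume "x \<in> carrier M'"
      then obtain y where "y \<in> carrier M" "x = f y" using M' by auto
      then show "\<exists>y\<in>carrier M'. y \<oplus>\<^bsub>M'\<^esub> x = \<zero>\<^bsub>M'\<^esub>"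
        by (intro bexI[of _ "f (\<ominus>\<^bsub>M\<^esub> y)"]) (simp_all add: M' add M.l_neg)
    qed (auto simp: M' add M.a_ac)
  qed (auto simp: M' add smult cring_CC smult_l_distr[simplified] smult_r_distr
      smult_assoc1[simplified] smult_one[simplified])
qed

text \<open>The common pattern behind projections onto a complement and coset maps: the target
  carries the image grading. The condition \<open>kernel\<close> says that the kernel is a graded
  subspace, which makes decompositions in the target unique.\<close>

locale graded_surj = linear_map W W' f + D: graded W
  for W :: "('i, 'v, 'a, 'y) vertex_space_scheme" and W' :: "('i, 'u, 'b, 'z) vertex_space_scheme"
    and f :: "'a \<Rightarrow> 'b" +
  assumes surj: "carrier W' = f ` carrier W"
    and grade_image: "grade W' i = f ` grade W i"
    and kernel: "x \<in> carrier W \<Longrightarrow> f x = \<zero>\<^bsub>W'\<^esub> \<Longrightarrow> f (comps W x i) = \<zero>\<^bsub>W'\<^esub>"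
begin

text \<open>Lift each \<open>c i\<close> to a homogeneous vector of \<open>W\<close>. The sum
  \<open>y\<close> of the lifts differs from \<open>w\<close> by an element of the kernel, and so do
  the components, since the kernel is graded.\<close>

lemma comps_unique:
  assumes w: "w \<in> carrier W" and c: "is_decomp W' (f w) c"
  shows "c i = f (comps W w i)"
proof -
  let ?S = "{i. c i \<noteq> \<zero>\<^bsub>W'\<^esub>}"
  \<comment> \<open>Where \<open>c i\<close> vanishes the lift is chosen to be zero, so that the
    family of lifts has finite support.\<close>
  have "\<exists>x\<in>grade W i. f x = c i \<and> (c i = \<zero>\<^bsub>W'\<^esub> \<longrightarrow> x = \<zero>\<^bsub>W\<^esub>)" for i
  proof (cases "c i = \<zero>\<^bsub>W'\<^esub>")
    case True
    then show ?thesis using D.zero_in_grade zero by auto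
  next
    case False
    moreover have "c i \<in> f ` grade W i" using c by (simp add: is_decomp_def flip: grade_image)
    ultimately show ?thesis by auto
  qed
  then obtain x where x: "\<And>i. x i \<in> grade W i" "\<And>i. f (x i) = c i"
    "\<And>i. c i = \<zero>\<^bsub>W'\<^esub> \<Longrightarrow> x i = \<zero>\<^bsub>W\<^esub>" by metis
  have xc: "x i \<in> carrier W" for i using x(1) D.grade_closed by blast
  define y where "y = (\<Oplus>\<^bsub>W\<^esub>i\<in>?S. x i)"
  have y: "y \<in> carrier W" unfolding y_def using xc by (intro D.finsum_closed) auto
  have cy: "comps W y = x"
    by (rule D.comps_eqI[OF D.decompI y]) (use x c in \<open>auto simp: y_def is_decomp_def\<close>)
  have "f y = f w"
    using c finsum[of x ?S] xc x(2) by (simp add: y_def is_decomp_def)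
  then have "f (y \<ominus>\<^bsub>W\<^esub> w) = \<zero>\<^bsub>W'\<^esub>" using w y closed by (simp add: minus) (simp add: a_minus_def C.r_neg)
  then have 0: "f (comps W (y \<ominus>\<^bsub>W\<^esub> w) i) = \<zero>\<^bsub>W'\<^esub>" using kernel w y by simp
  have "y = (y \<ominus>\<^bsub>W\<^esub> w) \<oplus>\<^bsub>W\<^esub> w" using w y by (simp add: a_minus_def D.a_assoc D.l_neg)
  then have "x i = comps W (y \<ominus>\<^bsub>W\<^esub> w) i \<oplus>\<^bsub>W\<^esub> comps W w i"
    using D.comps_add[of "y \<ominus>\<^bsub>W\<^esub> w" w i] cy w y by simp
  then have "c i = f (comps W (y \<ominus>\<^bsub>W\<^esub> w) i) \<oplus>\<^bsub>W'\<^esub> f (comps W w i)"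
    using add D.comps_closed w y x(2) by (metis D.minus_closed)
  then show ?thesis using 0 closed w D.comps_closed by simp
qed

lemma graded_space_image: "graded_space W'"
  unfolding graded_space_def
proof (intro conjI allI ballI)
  show "submodule (grade W' i) CC W'" for i
    unfolding grade_image using D.submodule_grade by (rule submodule_image)
  fix w' assume "w' \<in> carrier W'"
  then obtain w where w: "w \<in> carrier W" "w' = f w" using surj by auto
  let ?c = "\<lambda>i. f (comps W w i)"
  have "is_decomp W' w' ?c"
  proof (rule is_decompI[OF C.abelian_monoid_axioms _ _ D.finite_comps[OF w(1)]])
    show "w' = (\<Oplus>\<^bsub>W'\<^esub>i\<in>{i. comps W w i \<noteq> \<zero>\<^bsub>W\<^esub>}. ?c i)"
      using w finsum[of "comps W w" "{i. comps W w i \<noteq> \<zero>\<^bsub>W\<^esub>}"]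
      by (simp add: D.comps_closed D.finsum_comps)
  qed (use w in \<open>auto simp: grade_image zero closed D.comps_closed D.comps_in_grade\<close>)
  moreover have "c = ?c" if "is_decomp W' w' c" for c
    using that comps_unique w by blast
  ultimately show "\<exists>!c. is_decomp W' w' c" by blast
qed (rule cod)

sublocale graded_map W W' f
  by unfold_locales (auto simp: graded_space_image grade_image D.graded)

end

lemma sub_mod_simps [simp]:
  "carrier (sub_mod W T) = T" "grade (sub_mod W T) m = grade W m \<inter> T" "add (sub_mod W T) = add W"
  "zero (sub_mod W T) = zero W" "smult (sub_mod W T) = smult W" "Yop (sub_mod W T) = Yop W"
  by (simp_all add: sub_mod_def)

lemma compl_mod_simps [simp]:
  "carrier (compl_mod W A B) = A" "grade (compl_mod W A B) m = proj W A B ` grade W m"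
  "add (compl_mod W A B) = add W" "zero (compl_mod W A B) = zero W"
  "smult (compl_mod W A B) = smult W"
  "Yop (compl_mod W A B) v w n = proj W A B (Yop W v w n)"
  by (simp_all add: compl_mod_def)

lemma quot_mod_simps [simp]:
  "carrier (quot_mod W T) = (\<lambda>w. T +>\<^bsub>W\<^esub> w) ` carrier W" "grade (quot_mod W T) m = (\<lambda>w. T +>\<^bsub>W\<^esub> w) ` grade W m"
  "add (quot_mod W T) = set_add W" "zero (quot_mod W T) = T"
  by (auto simp: quot_mod_def A_RCOSETS_def')

lemma linear_map_sub_mod:
  assumes "module CC W" "submodule T CC W"
  shows "linear_map (sub_mod W T) W (\<lambda>x. x)"
proof -
  interpret module CC W by fact
  have "module CC (sub_mod W T)"
    by (rule submodule_module[OF assms]) simp_all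
  then show ?thesis
    using assms(1) submoduleE(1)[OF assms(2)] by (intro linear_map.intro) auto
qed

text \<open>Closure of \<open>T\<close> under \<open>comps\<close> makes the decomposition of
  \<open>t\<close> in \<open>W\<close> a decomposition inside \<open>T\<close>; uniqueness is
  inherited from \<open>W\<close>.\<close>

lemma graded_map_sub_mod:
  assumes "graded_space W" "submodule T CC W" "\<And>t m. t \<in> T \<Longrightarrow> comps W t m \<in> T"
  shows "graded_map (sub_mod W T) W (\<lambda>x. x)"
proof -
  interpret C: graded W by unfold_locales fact
  interpret linear_map "sub_mod W T" W "\<lambda>x. x"
    by (rule linear_map_sub_mod) (use assms C.module_axioms in auto)
  have T: "x \<in> carrier W" if "x \<in> T" for x using closed that by simp
  have "graded_space (sub_mod W T)"
    unfolding graded_space_def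
  proof (intro conjI allI ballI)
    fix i
    \<comment> \<open>The preimage of \<open>grade W i\<close> under the inclusion.\<close>
    have "grade (sub_mod W T) i = {x \<in> carrier (sub_mod W T). x \<in> grade W i}" by auto
    then show "submodule (grade (sub_mod W T) i) CC (sub_mod W T)"
      using submodule_vimage[OF C.submodule_grade[of i]] by argo
  next
    fix t assume "t \<in> carrier (sub_mod W T)"
    then have t: "t \<in> T" by simp
    have fin: "finite {i. comps W t i \<noteq> \<zero>\<^bsub>W\<^esub>}" using C.finite_comps T t by blast
    have "is_decomp (sub_mod W T) t (comps W t)"
    proof (rule is_decompI[OF D.abelian_monoid_axioms _ _ fin])
      have "comps W t \<in> {i. comps W t i \<noteq> \<zero>\<^bsub>W\<^esub>} \<rightarrow> carrier (sub_mod W T)"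
        using t assms(3) by simp
      then show "t = (\<Oplus>\<^bsub>sub_mod W T\<^esub>i\<in>{i. comps W t i \<noteq> \<zero>\<^bsub>W\<^esub>}. comps W t i)"
        by (subst finsum) (simp_all add: C.finsum_comps T t)
    qed (use t T assms(3) in \<open>auto simp: C.comps_in_grade\<close>)
    moreover have "c = comps W t" if c: "is_decomp (sub_mod W T) t c" for c
    proof -
      have "is_decomp W t c"
      proof (rule C.decompI[of _ "{i. c i \<noteq> \<zero>\<^bsub>W\<^esub>}"])
        show "t = (\<Oplus>\<^bsub>W\<^esub>i\<in>{i. c i \<noteq> \<zero>\<^bsub>W\<^esub>}. c i)"
          using c by (subst finsum[symmetric]) (auto simp: is_decomp_def)
      qed (use c in \<open>auto simp: is_decomp_def\<close>)
      then show ?thesis using C.comps_eqI T t by blast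
    qed
    ultimately show "\<exists>!c. is_decomp (sub_mod W T) t c" by blast
  qed (rule dom)
  then show ?thesis
    by (intro graded_map.intro linear_map_axioms graded_map_axioms.intro C.graded) simp_all
qed

section \<open>Projections of a direct sum\<close>

locale decomposed =
  fixes W :: "('v, 'w) left_mod" (structure) and A B :: "'w set"
  assumes module: "module CC W" and direct: "direct_sum W A B"
begin

sublocale module CC W by (rule module)

lemma submodules: "submodule A CC W" "submodule B CC W"
  using direct by (simp_all add: direct_sum_def)

lemmas A = submoduleE[OF submodules(1)]
lemmas B = submoduleE[OF submodules(2)]

lemma sub: "a \<in> A \<Longrightarrow> a \<in> carrier W" "b \<in> B \<Longrightarrow> b \<in> carrier W"
  using A(1) B(1) by blast+

lemma zeros: "\<zero> \<in> A" "\<zero> \<in> B"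
  using direct by (auto simp: direct_sum_def)

text \<open>For two decompositions the difference of the \<open>A\<close>-parts equals a difference
  of \<open>B\<close>-parts, hence lies in \<open>A \<inter> B\<close> and is zero.\<close>

lemma proj_eqI:
  assumes "a \<in> A" "b \<in> B" "w = a \<oplus> b"
  shows "proj W A B w = a"
  unfolding proj_def
proof (rule the_equality)
  fix a' assume "a' \<in> A \<and> (\<exists>b\<in>B. w = a' \<oplus> b)"
  then obtain b' where a': "a' \<in> A" "b' \<in> B" "w = a' \<oplus> b'" by blast
  note cs = sub(1)[OF assms(1)] sub(2)[OF assms(2)] sub(1)[OF a'(1)] sub(2)[OF a'(2)]
  have "a' \<ominus> a \<in> A" using A(3,5) assms a' by (simp add: a_minus_def)
  moreover have "b \<ominus> b' \<in> B" using B(3,5) assms a' by (simp add: a_minus_def)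
  moreover have "a' \<ominus> a = b \<ominus> b'"
  proof -
    have "a' \<oplus> b' = a \<oplus> b" using assms a' by simp
    then have "a' = (a \<oplus> b) \<ominus> b'" using cs by (metis a_minus_def add.inv_solve_right' a_closed)
    then have "a' \<ominus> a = (b \<ominus> b') \<oplus> (a \<oplus> \<ominus> a)" using cs by (simp add: a_minus_def a_ac)
    then show ?thesis using cs by (simp add: r_neg)
  qed
  ultimately have "a' \<ominus> a = \<zero>" using direct by (auto simp: direct_sum_def)
  moreover have "a' = (a' \<ominus> a) \<oplus> a" using cs by (simp add: a_minus_def a_assoc l_neg)
  ultimately show "a' = a" using cs by simp
qed (use assms in blast)

lemma decompose:
  assumes "w \<in> carrier W"
  obtains a b where "a \<in> A" "b \<in> B" "w = a \<oplus> b" "proj W A B w = a"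
  using assms direct proj_eqI unfolding direct_sum_def set_add_def' by blast

lemma proj_A: "a \<in> A \<Longrightarrow> proj W A B a = a"
  by (rule proj_eqI[OF _ zeros(2)]) (simp_all add: sub)

lemma proj_eq_zero: "w \<in> carrier W \<Longrightarrow> proj W A B w = \<zero> \<longleftrightarrow> w \<in> B"
proof
  assume w: "w \<in> carrier W"
  show "w \<in> B" if "proj W A B w = \<zero>" using decompose[OF w] that sub by (metis l_zero)
  show "proj W A B w = \<zero>" if "w \<in> B" by (rule proj_eqI[OF zeros(1) that]) (simp add: w)
qed

lemma linear_map_proj: "linear_map W (compl_mod W A B) (proj W A B)"
proof (rule linear_map.intro)
  show "module CC (compl_mod W A B)"
    by (rule submodule_module[OF module submodules(1)]) simp_all
next
  show "proj W A B x \<in> carrier (compl_mod W A B)" if "x \<in> carrier W" for x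
    using decompose[OF that] by (metis compl_mod_simps(1))
  fix x assume x: "x \<in> carrier W"
  obtain a b where ab: "a \<in> A" "b \<in> B" "x = a \<oplus> b" "proj W A B x = a" using decompose[OF x] .
  show "proj W A B (c \<odot> x) = c \<odot>\<^bsub>compl_mod W A B\<^esub> proj W A B x" for c
  proof -
    have "c \<odot> a \<in> A" "c \<odot> b \<in> B" using ab A(4) B(4) by simp_all
    moreover have "c \<odot> x = c \<odot> a \<oplus> c \<odot> b" using ab by (simp add: smult_r_distr sub)
    ultimately show ?thesis using proj_eqI ab by simp
  qed
  fix y assume y: "y \<in> carrier W"
  obtain a' b' where ab': "a' \<in> A" "b' \<in> B" "y = a' \<oplus> b'" "proj W A B y = a'"
    using decompose[OF y] .
  have "x \<oplus> y = (a \<oplus> a') \<oplus> (b \<oplus> b')"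
    using ab ab' by (simp add: sub a_ac)
  then show "proj W A B (x \<oplus> y) = proj W A B x \<oplus>\<^bsub>compl_mod W A B\<^esub> proj W A B y"
    using ab ab' A B proj_eqI by simp
qed (rule module)

lemma proj_image: "A = proj W A B ` carrier W"
proof
  show "A \<subseteq> proj W A B ` carrier W" using proj_A sub by (metis image_eqI subsetI)
  show "proj W A B ` carrier W \<subseteq> A" using linear_map.closed[OF linear_map_proj] by auto
qed

text \<open>Makes the facts about \<open>proj W A B\<close> available for \<open>proj W B A\<close>,
  the projection onto the submodule.\<close>

lemma swap: "decomposed W B A"
proof
  have "b \<oplus> a = a \<oplus> b" if "a \<in> A" "b \<in> B" for a b
    using that sub a_comm by blast
  then have "B <+>\<^bsub>W\<^esub> A = A <+>\<^bsub>W\<^esub> B"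
    unfolding set_add_def' by fastforce
  then show "direct_sum W B A" using direct by (auto simp: direct_sum_def)
qed

text \<open>The kernel of the projection is \<open>B\<close>, which is a graded subspace. Hence the
  projected grading on \<open>A\<close> is a grading even if \<open>A\<close> itself is not a graded
  subspace of \<open>W\<close>.\<close>

lemma graded_surj_proj:
  assumes "graded_space W" "\<And>b m. b \<in> B \<Longrightarrow> comps W b m \<in> B"
  shows "graded_surj W (compl_mod W A B) (proj W A B)"
proof -
  interpret graded W by unfold_locales fact
  interpret linear_map W "compl_mod W A B" "proj W A B" by (rule linear_map_proj)
  show ?thesis
    by unfold_locales (use proj_image assms in \<open>auto simp: proj_eq_zero comps_closed\<close>)
qed

end

section \<open>The quotient by a subspace as a space of cosets\<close>

locale quotient =
  fixes W :: "('v, 'w) left_mod" (structure) and T :: "'w set"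
  assumes module: "module CC W" and submodule: "submodule T CC W"
begin

sublocale module CC W by (rule module)

sublocale T: abelian_subgroup T W
  using submodule submodule_def by (intro abelian_subgroupI3) (auto intro: additive_subgroup.intro abelian_group_axioms)

abbreviation coset where "coset w \<equiv> T +>\<^bsub>W\<^esub> w"

lemma coset_zero: "coset \<zero> = T"
  by (rule a_coset_add_zero[OF T.a_subset])

lemma coset_self: "w \<in> carrier W \<Longrightarrow> w \<in> coset w"
  by (rule T.a_rcos_self)

lemma coset_eq_iff: "x \<in> carrier W \<Longrightarrow> y \<in> carrier W \<Longrightarrow> coset x = coset y \<longleftrightarrow> x \<ominus> y \<in> T"
  using T.a_rcos_module[of y x] T.a_repr_independence'[of x y] T.a_rcos_self[of x]
  by (metis a_minus_def)

lemma coset_eqI: "x \<in> coset w \<Longrightarrow> w \<in> carrier W \<Longrightarrow> coset x = coset w"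
  using T.a_repr_independence'[of x w] by simp

lemma coset_carrier: "x \<in> coset w \<Longrightarrow> w \<in> carrier W \<Longrightarrow> x \<in> carrier W"
  by (rule T.a_elemrcos_carrier)

text \<open>Scalar multiplication and vertex operators on \<open>quot_mod\<close> are unions over
  representatives. Representatives differ by elements of \<open>T\<close>, which \<open>h\<close>
  maps into \<open>T\<close>, so all members of the union coincide.\<close>

lemma coset_lift:
  assumes "linear_map W W h" "\<And>t. t \<in> T \<Longrightarrow> h t \<in> T" "w \<in> carrier W"
  shows "(\<Union>x\<in>coset w. coset (h x)) = coset (h w)"
proof -
  interpret h: linear_map W W h by fact
  have "coset (h x) = coset (h w)" if x: "x \<in> coset w" for x
  proof -
    note xc = coset_carrier[OF x assms(3)]
    have "x \<ominus> w \<in> T" using coset_eq_iff coset_eqI[OF x] xc assms(3) by blast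
    then have "h (x \<ominus> w) \<in> T" using assms(2) by blast
    then show ?thesis using coset_eq_iff xc assms(3) by (simp add: h.minus h.closed)
  qed
  then show ?thesis using coset_self[OF assms(3)] by blast
qed

lemma smult_coset:
  assumes "w \<in> carrier W"
  shows "a \<odot>\<^bsub>quot_mod W T\<^esub> coset w = coset (a \<odot> w)"
proof -
  have "linear_map W W (\<lambda>x. a \<odot> x)"
    by (rule linear_map.intro) (simp_all add: smult_r_distr module smult_commute)
  then show ?thesis using coset_lift[of "\<lambda>x. a \<odot> x" w] submoduleE(4)[OF submodule] assms
    by (simp add: quot_mod_def)
qed

lemma linear_map_coset: "linear_map W (quot_mod W T) coset"
proof (rule linear_map.intro)
  show "module CC (quot_mod W T)"
    by (rule module_image[OF module, where f = coset])
      (simp_all add: coset_zero T.a_rcos_sum smult_coset)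
qed (use module in \<open>auto simp: T.a_rcos_sum smult_coset\<close>)

lemma coset_eq_zero: "w \<in> carrier W \<Longrightarrow> coset w = T \<longleftrightarrow> w \<in> T"
proof -
  assume w: "w \<in> carrier W"
  have "w \<ominus> \<zero> = w" using w by (simp add: a_minus_def add.inv_one)
  then show ?thesis using w coset_eq_iff[of w \<zero>] coset_zero by simp
qed

lemma graded_surj_coset:
  assumes "graded_space W" "\<And>t m. t \<in> T \<Longrightarrow> comps W t m \<in> T"
  shows "graded_surj W (quot_mod W T) coset"
proof -
  interpret graded W by unfold_locales fact
  interpret linear_map W "quot_mod W T" coset by (rule linear_map_coset)
  show ?thesis
    by unfold_locales (use assms in \<open>auto simp: coset_eq_zero comps_closed\<close>)
qed

end

section \<open>Left modules along homomorphisms\<close>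

lemma vertex_mapD:
  assumes "vertex_map V W" "u \<in> carrier V" "w \<in> carrier W"
  shows "Yop W u w n \<in> carrier W"
    and "u' \<in> carrier V \<Longrightarrow> Yop W (u \<oplus>\<^bsub>V\<^esub> u') w n = Yop W u w n \<oplus>\<^bsub>W\<^esub> Yop W u' w n"
    and "Yop W (a \<odot>\<^bsub>V\<^esub> u) w n = a \<odot>\<^bsub>W\<^esub> Yop W u w n"
    and "w' \<in> carrier W \<Longrightarrow> Yop W u (w \<oplus>\<^bsub>W\<^esub> w') n = Yop W u w n \<oplus>\<^bsub>W\<^esub> Yop W u w' n"
    and "Yop W u (a \<odot>\<^bsub>W\<^esub> w) n = a \<odot>\<^bsub>W\<^esub> Yop W u w n"
  using assms unfolding vertex_map_def by blast+

section \<open>Weights and truncation of vertex operators\<close>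

locale vertex_module = V: mosva V + left_module V W
  for V :: "'v vertex_algebra" and W :: "('v, 'w) left_mod" (structure)
begin

sublocale GV: graded V by unfold_locales (rule V.graded)
sublocale graded W by unfold_locales (rule graded)

lemmas Y = vertex_mapD[OF vertex_map]

lemma Yop_zero_left: "w \<in> carrier W \<Longrightarrow> Yop W \<zero>\<^bsub>V\<^esub> w n = \<zero>"
  using Y(3)[of "\<zero>\<^bsub>V\<^esub>" w 0 n] Y(1)[of "\<zero>\<^bsub>V\<^esub>" w n] GV.smult_l_null[of "\<zero>\<^bsub>V\<^esub>"]
    smult_l_null[of "Yop W \<zero>\<^bsub>V\<^esub> w n"] by simp

lemma Yop_zero_right: "u \<in> carrier V \<Longrightarrow> Yop W u \<zero> n = \<zero>"
  using Y(5)[of u \<zero> 0 n] Y(1)[of u \<zero> n] smult_l_null[of \<zero>]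
    smult_l_null[of "Yop W u \<zero> n"] by simp

text \<open>By the bracket formula the coefficient is an eigenvector of \<open>dW W\<close>, and
  eigenvectors are homogeneous. The weight has no further shift because \<open>n\<close> is the
  exponent of the variable and not a mode index.\<close>

lemma Yop_grade:
  assumes u: "u \<in> grade V k" and w: "w \<in> grade W m"
  shows "Yop W u w n \<in> grade W (of_int k + of_int n + m)"
proof -
  let ?y = "Yop W u w n"
  have uc: "u \<in> carrier V" using u by (rule GV.grade_closed)
  have wc: "w \<in> carrier W" using w by (rule grade_closed)
  have yc: "?y \<in> carrier W" using uc wc by (rule Y)
  have dy: "dW W ?y \<in> carrier W" using yc unfolding dW_def by (rule diag_op_closed)
  have "dW W ?y \<ominus> m \<odot> ?y = of_int k \<odot> ?y \<oplus> of_int n \<odot> ?y"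
    using d_bracket[OF uc wc, of n] u w uc wc
    by (simp add: dW_def dV_def diag_op_homogeneous GV.diag_op_homogeneous Y)
  then have "dW W ?y \<ominus> m \<odot> ?y = (of_int k + of_int n) \<odot> ?y"
    using smult_l_distr[of "of_int k" "of_int n" ?y] yc by simp
  moreover have "dW W ?y = (dW W ?y \<ominus> m \<odot> ?y) \<oplus> m \<odot> ?y"
    using dy yc by (simp add: a_minus_def a_assoc l_neg)
  ultimately have "dW W ?y = (of_int k + of_int n + m) \<odot> ?y"
    using smult_l_distr[of "of_int k + of_int n" m ?y] yc by simp
  then show ?thesis using diag_op_eigenvector[OF graded yc] by simp
qed

text \<open>For homogeneous \<open>u\<close> and \<open>w\<close> the coefficients of very negative
  exponent have weight below the lower bound of the grading. Two inductions over sums of homogeneous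
  vectors give the general case.\<close>

lemma truncation:
  assumes u: "u \<in> carrier V" and w: "w \<in> carrier W"
  shows "\<exists>n0. \<forall>n<n0. Yop W u w n = \<zero>"
  using u
proof (induct u rule: GV.graded_induct)
  case zero
  then show ?case using w Yop_zero_left by blast
next
  case (add u u')
  then obtain n0 n1 where "\<forall>n<n0. Yop W u w n = \<zero>" "\<forall>n<n1. Yop W u' w n = \<zero>" by blast
  then show ?case using add(1,2) w by (intro exI[of _ "min n0 n1"]) (simp add: Y)
next
  case (homogeneous u k)
  note u = homogeneous and uc = GV.grade_closed[OF homogeneous]
  show ?case using w
  proof (induct w rule: graded_induct)
    case zero
    then show ?case using uc Yop_zero_right by blast
  next
    case (add w w')
    then obtain n0 n1 where "\<forall>n<n0. Yop W u w n = \<zero>" "\<forall>n<n1. Yop W u w' n = \<zero>" by blast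
    then show ?case using add(1,2) uc by (intro exI[of _ "min n0 n1"]) (simp add: Y)
  next
    case (homogeneous w m)
    obtain r :: real where r: "\<forall>m. Re m < r \<longrightarrow> grade W m = {\<zero>}" using lower_bound by blast
    \<comment> \<open>The bound forces the real part \<open>k + n + Re m\<close> of the weight below
      \<open>r\<close>.\<close>
    have "Yop W u w n = \<zero>" if "n < \<lfloor>r - Re m\<rfloor> - k" for n
    proof -
      have "real_of_int k + real_of_int n + Re m < r" using that by linarith
      then show ?thesis using r Yop_grade[OF u homogeneous, of n] by auto
    qed
    then show ?case by blast
  qed
qed

text \<open>
  An infinite \<open>\<Oplus>\<close> has the junk value \<open>\<zero>\<close>, so \<open>product_coeff\<close> commutes with a map that shrinks supports
  only because they are finite in the source.
\<close>

lemma finite_Yop_support: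
  assumes "u \<in> carrier V" "w \<in> carrier W"
  shows "finite {j::nat. Yop W u w (b - int j) \<noteq> \<zero>}"
proof -
  obtain n0 where n0: "\<forall>n<n0. Yop W u w n = \<zero>" using truncation[OF assms] by blast
  have "{j::nat. Yop W u w (b - int j) \<noteq> \<zero>} \<subseteq> {..nat (b - n0)}"
  proof
    fix j assume "j \<in> {j::nat. Yop W u w (b - int j) \<noteq> \<zero>}"
    then have "\<not> b - int j < n0" using n0 by auto
    then show "j \<in> {..nat (b - n0)}" by simp
  qed
  then show ?thesis using finite_subset by blast
qed

end

section \<open>Homomorphisms and transfer of the module axioms\<close>

locale vertex_hom = graded_map W W' f
  for V :: "'v vertex_algebra" and W :: "('v, 'a) left_mod" and W' :: "('v, 'b) left_mod"
    and f :: "'a \<Rightarrow> 'b" +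
  assumes Yop_closed: "u \<in> carrier V \<Longrightarrow> w \<in> carrier W \<Longrightarrow> Yop W u w n \<in> carrier W"
    and Yop: "u \<in> carrier V \<Longrightarrow> w \<in> carrier W \<Longrightarrow> f (Yop W u w n) = Yop W' u (f w) n"
begin

lemma product_coeff_closed:
  "u1 \<in> carrier V \<Longrightarrow> u2 \<in> carrier V \<Longrightarrow> w \<in> carrier W \<Longrightarrow> product_coeff W u1 u2 w a b \<in> carrier W"
  unfolding product_coeff_def by (rule D.finsum_closed) (auto simp: Yop_closed)

text \<open>The two sums run over the supports before and after applying \<open>f\<close>. An index
  lost on the way has its inner coefficient mapped to zero, and \<open>Y0\<close> makes the outer
  operator vanish there.\<close>

lemma product_coeff:
  assumes u: "u1 \<in> carrier V" "u2 \<in> carrier V" and w: "w \<in> carrier W"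
    and Y0: "\<And>n. Yop W u1 \<zero>\<^bsub>W\<^esub> n = \<zero>\<^bsub>W\<^esub>"
    and fin: "finite {j::nat. Yop W u2 w (b - int j) \<noteq> \<zero>\<^bsub>W\<^esub>}"
  shows "f (product_coeff W u1 u2 w a b) = product_coeff W' u1 u2 (f w) a b"
proof -
  let ?S = "{j::nat. Yop W u2 w (b - int j) \<noteq> \<zero>\<^bsub>W\<^esub>}"
  let ?t = "\<lambda>j. (of_int (a + int j) gchoose j) \<odot>\<^bsub>W\<^esub> Yop W u1 (Yop W u2 w (b - int j)) (a + int j)"
  have t: "?t j \<in> carrier W" for j using u w by (simp add: Yop_closed)
  have "f (product_coeff W u1 u2 w a b) = (\<Oplus>\<^bsub>W'\<^esub>j\<in>?S. f (?t j))"
    unfolding product_coeff_def using t by (intro finsum) simp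
  also have "\<dots> = (\<Oplus>\<^bsub>W'\<^esub>j\<in>{j::nat. f (Yop W u2 w (b - int j)) \<noteq> \<zero>\<^bsub>W'\<^esub>}. f (?t j))"
  proof (rule C.finsum_support[OF fin])
    show "{j::nat. f (Yop W u2 w (b - int j)) \<noteq> \<zero>\<^bsub>W'\<^esub>} \<subseteq> ?S" by (auto simp: zero)
    show "(\<lambda>j. f (?t j)) \<in> ?S \<rightarrow> carrier W'" using t closed by simp
    fix j assume "j \<in> ?S - {j. f (Yop W u2 w (b - int j)) \<noteq> \<zero>\<^bsub>W'\<^esub>}"
    then have 0: "f (Yop W u2 w (b - int j)) = \<zero>\<^bsub>W'\<^esub>" by simp
    have "Yop W' u1 \<zero>\<^bsub>W'\<^esub> n = \<zero>\<^bsub>W'\<^esub>" for n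
      using Yop[OF u(1), of "\<zero>\<^bsub>W\<^esub>" n] zero Y0 by simp
    then show "f (?t j) = \<zero>\<^bsub>W'\<^esub>"
      using u w by (simp add: smult Yop Yop_closed 0)
  qed
  also have "\<dots> = product_coeff W' u1 u2 (f w) a b"
    unfolding product_coeff_def using u w by (simp add: Yop[symmetric] smult Yop_closed)
  finally show ?thesis .
qed

lemma iterate_coeff:
  assumes "Yop V u1 u2 a \<in> carrier V" "w \<in> carrier W"
  shows "iterate_coeff V W u1 u2 w a b \<in> carrier W"
    and "f (iterate_coeff V W u1 u2 w a b) = iterate_coeff V W' u1 u2 (f w) a b"
  using assms by (simp_all add: iterate_coeff_def Yop Yop_closed)

lemma mult_binomial_power:
  assumes "\<And>a b. F a b \<in> carrier W"
  shows "f (mult_binomial_power W p F a b) = mult_binomial_power W' p (\<lambda>a b. f (F a b)) a b"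
  unfolding mult_binomial_power_def using assms
  by (simp add: finsum smult)

end

text \<open>Every vector of \<open>W'\<close> is some \<open>f x\<close>, and the identities among
  the axioms are images under \<open>f\<close> of those for \<open>x\<close>. This yields the
  quotient module.\<close>

lemma left_module_image:
  fixes V :: "'v vertex_algebra" and W :: "('v, 'a) left_mod" and W' :: "('v, 'b) left_mod"
  assumes "mosva V" "left_module V W" and surj: "graded_surj W W' f"
    and Yop_f: "\<And>u w n. u \<in> carrier V \<Longrightarrow> w \<in> carrier W \<Longrightarrow> Yop W' u (f w) n = f (Yop W u w n)"
  shows "left_module V W'"
proof -
  interpret W: vertex_module V W
    using assms(1,2) by (rule vertex_module.intro)
  interpret graded_surj W W' f by (rule surj)
  interpret vertex_hom V W W' f
    by unfold_locales (simp_all add: Yop_f W.Y)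
  note VY = vertex_mapD[OF W.V.vertex_map]
  \<comment> \<open>Most of these equations are reversed so as to collect \<open>f\<close> at the
    outside of each term, which leaves \<open>f\<close> applied to an axiom of
    \<open>W\<close>.\<close>
  note simps = W.Y closed add[symmetric] smult[symmetric] minus[symmetric] Yop_f diag_op[symmetric]
    W.diag_op_closed W.GV.diag_op_closed VY W.V.vac_closed
  have grade_zero: "\<exists>r. \<forall>m. Re m < r \<longrightarrow> grade W' m = {\<zero>\<^bsub>W'\<^esub>}"
  proof -
    obtain r where "\<forall>m. Re m < r \<longrightarrow> grade W m = {\<zero>\<^bsub>W\<^esub>}" using W.lower_bound by blast
    then have "\<forall>m. Re m < r \<longrightarrow> grade W' m = {\<zero>\<^bsub>W'\<^esub>}" by (simp add: grade_image zero)
    then show ?thesis by blast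
  qed
  have assoc: "weak_associativity V W'"
    unfolding weak_associativity_def surj ball_simps
  proof (intro ballI)
    fix u1 w assume u1: "u1 \<in> carrier V" and w: "w \<in> carrier W"
    \<comment> \<open>The exponent belonging to the preimage \<open>w\<close> also serves for
      \<open>f w\<close>.\<close>
    obtain p where p: "\<And>u2. u2 \<in> carrier V \<Longrightarrow>
        mult_binomial_power W p (product_coeff W u1 u2 w) =
        mult_binomial_power W p (iterate_coeff V W u1 u2 w)"
      using W.weak_assoc u1 w unfolding weak_associativity_def by blast
    have "mult_binomial_power W' p (product_coeff W' u1 u2 (f w)) =
        mult_binomial_power W' p (iterate_coeff V W' u1 u2 (f w))" if u2: "u2 \<in> carrier V" for u2
    proof -
      have 1: "product_coeff W' u1 u2 (f w) = (\<lambda>a b. f (product_coeff W u1 u2 w a b))"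
        using product_coeff[OF u1 u2 w W.Yop_zero_right[OF u1] W.finite_Yop_support[OF u2 w]]
        by (intro ext) simp
      have 2: "iterate_coeff V W' u1 u2 (f w) = (\<lambda>a b. f (iterate_coeff V W u1 u2 w a b))"
        using iterate_coeff(2)[OF VY(1)[OF u1 u2] w] by (intro ext) simp
      show ?thesis
        using p[OF u2] mult_binomial_power[of "product_coeff W u1 u2 w" p]
          mult_binomial_power[of "iterate_coeff V W u1 u2 w" p]
          product_coeff_closed[OF u1 u2 w] iterate_coeff(1)[OF VY(1)[OF u1 u2] w]
        unfolding 1 2 by (intro ext) simp
    qed
    then show "\<exists>p. \<forall>u2\<in>carrier V. mult_binomial_power W' p (product_coeff W' u1 u2 (f w)) =
        mult_binomial_power W' p (iterate_coeff V W' u1 u2 (f w))" by blast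
  qed
  show ?thesis
  proof
    show "vertex_map V W'"
      unfolding vertex_map_def surj by (simp add: simps)
  next
    fix u w n assume u: "u \<in> carrier V" and "w \<in> carrier W'"
    then obtain x where x: "x \<in> carrier W" "w = f x" using surj by auto
    have "f (dW W (Yop W u x n) \<ominus>\<^bsub>W\<^esub> Yop W u (dW W x) n) =
        f (Yop W (dV V u) x n \<oplus>\<^bsub>W\<^esub> of_int n \<odot>\<^bsub>W\<^esub> Yop W u x n)"
      using W.d_bracket[OF u x(1)] by simp
    then show "dW W' (Yop W' u w n) \<ominus>\<^bsub>W'\<^esub> Yop W' u (dW W' w) n =
        Yop W' (dV V u) w n \<oplus>\<^bsub>W'\<^esub> of_int n \<odot>\<^bsub>W'\<^esub> Yop W' u w n"
      using u x by (simp add: simps dW_def dV_def)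
    have "f (of_int (n + 1) \<odot>\<^bsub>W\<^esub> Yop W u x (n + 1)) = f (Yop W (Dop V u) x n)"
      using W.D_derivative[OF u x(1)] by simp
    then show "of_int (n + 1) \<odot>\<^bsub>W'\<^esub> Yop W' u w (n + 1) = Yop W' (Dop V u) w n"
      using u x by (simp add: simps Dop_def)
  next
    fix w n assume "w \<in> carrier W'"
    then obtain x where x: "x \<in> carrier W" "w = f x" using surj by auto
    then show "Yop W' (vac V) w n = (if n = 0 then w else \<zero>\<^bsub>W'\<^esub>)"
      using W.identity by (simp add: simps zero)
  qed (fact graded_cod grade_zero assoc)+
qed

text \<open>Here the axioms are pulled back along the inclusion, an injective homomorphism, so each
  identity in \<open>W\<close> between elements of \<open>T\<close> is already one in
  \<open>T\<close>.\<close>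

lemma left_module_sub_mod:
  fixes V :: "'v vertex_algebra" and W :: "('v, 'w) left_mod"
  assumes "mosva V" "left_module V W" "vsubmodule V W T"
  shows "left_module V (sub_mod W T)"
proof -
  interpret W: vertex_module V W
    using assms(1,2) by (rule vertex_module.intro)
  interpret graded_map "sub_mod W T" W "\<lambda>x. x"
    using assms(3) W.graded by (intro graded_map_sub_mod) (auto simp: vsubmodule_def)
  interpret vertex_hom V "sub_mod W T" W "\<lambda>x. x"
    using assms(3) by unfold_locales (auto simp: vsubmodule_def)
  note VY = vertex_mapD[OF W.V.vertex_map]
  have T: "t \<in> carrier W" if "t \<in> T" for t using closed that by simp
  have Y: "Yop W u t n \<in> T" if "u \<in> carrier V" "t \<in> T" for u t n using Yop_closed that by simp
  \<comment> \<open>The operator of \<open>T\<close> is defined through decompositions in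
    \<open>T\<close>, and subtraction in \<open>T\<close> through inverses in its own carrier. Both
    agree with those of \<open>W\<close> because the inclusion is a graded linear map.\<close>
  have dW: "dW (sub_mod W T) t = dW W t" "dW W t \<in> T" if "t \<in> T" for t
    using diag_op[of t] D.diag_op_closed[of t] that by (simp_all add: dW_def)
  have minus: "x \<ominus>\<^bsub>sub_mod W T\<^esub> y = x \<ominus>\<^bsub>W\<^esub> y" if "x \<in> T" "y \<in> T" for x y
    using minus that by simp
  have assoc: "weak_associativity V (sub_mod W T)"
    unfolding weak_associativity_def
  proof (intro ballI)
    fix u1 w assume u1: "u1 \<in> carrier V" and w': "w \<in> carrier (sub_mod W T)"
    then have w: "w \<in> carrier W" using T by simp
    obtain p where p: "\<And>u2. u2 \<in> carrier V \<Longrightarrow>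
        mult_binomial_power W p (product_coeff W u1 u2 w) =
        mult_binomial_power W p (iterate_coeff V W u1 u2 w)"
      using W.weak_assoc u1 w unfolding weak_associativity_def by blast
    have "mult_binomial_power (sub_mod W T) p (product_coeff (sub_mod W T) u1 u2 w) =
        mult_binomial_power (sub_mod W T) p (iterate_coeff V (sub_mod W T) u1 u2 w)"
      if u2: "u2 \<in> carrier V" for u2
    proof -
      have 1: "product_coeff (sub_mod W T) u1 u2 w = product_coeff W u1 u2 w"
        using product_coeff[OF u1 u2 w'] W.Yop_zero_right[OF u1] W.finite_Yop_support[OF u2 w]
        by (intro ext) simp
      have 2: "iterate_coeff V (sub_mod W T) u1 u2 w = iterate_coeff V W u1 u2 w"
        by (intro ext) (simp add: iterate_coeff_def)
      show ?thesis
        using p[OF u2] mult_binomial_power[of "product_coeff W u1 u2 w" p]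
          mult_binomial_power[of "iterate_coeff V W u1 u2 w" p]
          product_coeff_closed[OF u1 u2 w'] iterate_coeff(1)[OF VY(1)[OF u1 u2] w']
        unfolding 1 2 by (intro ext) simp
    qed
    then show "\<exists>p. \<forall>u2\<in>carrier V.
        mult_binomial_power (sub_mod W T) p (product_coeff (sub_mod W T) u1 u2 w) =
        mult_binomial_power (sub_mod W T) p (iterate_coeff V (sub_mod W T) u1 u2 w)" by blast
  qed
  show ?thesis
  proof
    show "vertex_map V (sub_mod W T)"
      unfolding vertex_map_def using T Y by (auto simp: W.Y)
    show "\<exists>r. \<forall>m. Re m < r \<longrightarrow> grade (sub_mod W T) m = {\<zero>\<^bsub>sub_mod W T\<^esub>}"
      using W.lower_bound D.zero_closed by auto
  qed (use W.d_bracket W.D_derivative W.identity T Y dW minus in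
        \<open>simp_all add: graded_dom assoc\<close>)
qed

section \<open>Functoriality of the spaces \<open>\<H>\<^sub>N(W\<^sub>1,W\<^sub>2)\<close>\<close>

text \<open>The transpose of \<open>f\<close> on graded duals, acting degree by degree.\<close>

definition dual_map :: "('a \<Rightarrow> 'b) \<Rightarrow> (complex \<Rightarrow> 'b \<Rightarrow> complex) \<Rightarrow> complex \<Rightarrow> 'a \<Rightarrow> complex" where
  "dual_map f w' = (\<lambda>m x. w' m (f x))"

context vertex_hom
begin

lemma dual_supp_dual_map: "dual_supp W (dual_map f w') \<subseteq> dual_supp W' w'"
  by (auto simp: dual_supp_def dual_map_def intro: grade)

lemma dual_map_graded_dual:
  assumes "w' \<in> graded_dual W'"
  shows "dual_map f w' \<in> graded_dual W"
  using assms finite_subset[OF dual_supp_dual_map, of w']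
  by (simp add: graded_dual_def dual_map_def add smult D.grade_closed grade)

lemma pairing_dual_map:
  assumes "w' \<in> graded_dual W'" "h \<in> completion W"
  shows "pairing W' w' (\<lambda>m. f (h m)) = pairing W (dual_map f w') h"
  unfolding pairing_def
proof (rule sum.mono_neutral_cong_right)
  show "finite (dual_supp W' w')" using assms(1) by (simp add: graded_dual_def)
  \<comment> \<open>A functional can be nonzero in a degree where its transpose vanishes; such a
    degree contributes zero since \<open>h m\<close> is in \<open>grade W m\<close>.\<close>
  show "\<forall>m\<in>dual_supp W' w' - dual_supp W (dual_map f w'). w' m (f (h m)) = 0"
    using assms(2) by (auto simp: dual_supp_def dual_map_def completion_def)
qed (simp_all add: dual_supp_dual_map, simp add: dual_map_def)

lemma pairing_comps_dual_map:
  assumes "w' \<in> graded_dual W'" "u \<in> carrier W"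
  shows "pairing W' w' (comps W' (f u)) = pairing W (dual_map f w') (comps W u)"
  using pairing_dual_map[OF assms(1), of "comps W u"] assms(2)
  by (simp add: comps completion_def D.comps_in_grade)

text \<open>Pairing the image with \<open>w'\<close> is pairing the original with the transposed
  functional, so rationality carries over, with the same \<open>p\<close> and with the image of the
  series \<open>g\<close>.\<close>

lemma hat_space_map:
  assumes "h \<in> hat_space W"
  shows "(\<lambda>\<zeta> m. f (h \<zeta> m)) \<in> hat_space W'"
proof -
  have h: "h \<zeta> \<in> completion W" if "\<zeta> \<noteq> 0" for \<zeta> using assms that by (simp add: hat_space_def)
  have pair: "pairing W' w' (\<lambda>m. f (h \<zeta> m)) = pairing W (dual_map f w') (h \<zeta>)"
    if "w' \<in> graded_dual W'" "\<zeta> \<noteq> 0" for w' \<zeta>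
    using pairing_dual_map[OF that(1) h[OF that(2)]] .
  obtain p :: int and g :: "nat \<Rightarrow> 'a" where g: "\<And>n. g n \<in> carrier W"
    and pg: "\<And>w'. w' \<in> graded_dual W \<Longrightarrow> finite {n. pairing W w' (comps W (g n)) \<noteq> 0} \<and>
      (\<forall>\<zeta>. \<zeta> \<noteq> 0 \<longrightarrow> \<zeta> powi p * pairing W w' (h \<zeta>) =
         (\<Sum>n | pairing W w' (comps W (g n)) \<noteq> 0. pairing W w' (comps W (g n)) * \<zeta> ^ n))"
    using assms unfolding hat_space_def by blast
  have "\<forall>\<zeta>. \<zeta> \<noteq> 0 \<longrightarrow> (\<lambda>m. f (h \<zeta> m)) \<in> completion W'"
    using h by (auto simp: completion_def intro: grade)
  moreover have "\<forall>w'\<in>graded_dual W'. \<exists>(q::complex poly) (b::nat). \<forall>\<zeta>. \<zeta> \<noteq> 0 \<longrightarrow>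
      pairing W' w' (\<lambda>m. f (h \<zeta> m)) = poly q \<zeta> / \<zeta> ^ b"
    using assms dual_map_graded_dual pair unfolding hat_space_def by force
  moreover have "\<forall>w'\<in>graded_dual W'. finite {n. pairing W' w' (comps W' (f (g n))) \<noteq> 0} \<and>
      (\<forall>\<zeta>. \<zeta> \<noteq> 0 \<longrightarrow> \<zeta> powi p * pairing W' w' (\<lambda>m. f (h \<zeta> m)) =
         (\<Sum>n | pairing W' w' (comps W' (f (g n))) \<noteq> 0.
            pairing W' w' (comps W' (f (g n))) * \<zeta> ^ n))"
    using pg dual_map_graded_dual by (simp add: pairing_comps_dual_map g pair)
  moreover have "\<forall>n. f (g n) \<in> carrier W'" using g closed by blast
  ultimately show ?thesis unfolding hat_space_def
    by (simp, intro exI[of _ p] exI[of _ "\<lambda>n. f (g n)"]) simp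
qed

text \<open>Moving \<open>f\<close> onto the functional requires values in the completion. The
  predicate \<open>laurent_series\<close> does not state this, hence the second hypothesis.\<close>

lemma laurent_series_map:
  assumes "laurent_series W h c" "\<And>\<zeta>. \<zeta> \<noteq> 0 \<Longrightarrow> h \<zeta> \<in> completion W"
  shows "laurent_series W' (\<lambda>\<zeta> m. f (h \<zeta> m)) (\<lambda>n. f (c n))"
proof -
  have pair: "pairing W' w' (\<lambda>m. f (h \<zeta> m)) = pairing W (dual_map f w') (h \<zeta>)"
    if "w' \<in> graded_dual W'" "\<zeta> \<noteq> 0" for w' \<zeta>
    using pairing_dual_map[OF that(1) assms(2)[OF that(2)]] .
  have c: "c n \<in> carrier W" for n using assms(1) by (simp add: laurent_series_def)
  obtain n0 where "\<forall>n<n0. c n = \<zero>\<^bsub>W\<^esub>" using assms(1) by (auto simp: laurent_series_def)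
  then have "\<forall>n<n0. f (c n) = \<zero>\<^bsub>W'\<^esub>" by (simp add: zero)
  moreover have "\<forall>w'\<in>graded_dual W'. finite {n. pairing W' w' (comps W' (f (c n))) \<noteq> 0} \<and>
      (\<forall>\<zeta>. \<zeta> \<noteq> 0 \<longrightarrow> pairing W' w' (\<lambda>m. f (h \<zeta> m)) =
         (\<Sum>n | pairing W' w' (comps W' (f (c n))) \<noteq> 0.
            pairing W' w' (comps W' (f (c n))) * \<zeta> powi n))"
    using assms(1) dual_map_graded_dual by (simp add: laurent_series_def pairing_comps_dual_map c pair)
  ultimately show ?thesis unfolding laurent_series_def using c closed by blast
qed

lemma foldr_Yop:
  assumes "\<And>i. i \<in> set is \<Longrightarrow> v i \<in> carrier V" "w \<in> carrier W"
  shows "foldr (\<lambda>i u. Yop W (v i) u (e i)) is w \<in> carrier W \<and>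
    f (foldr (\<lambda>i u. Yop W (v i) u (e i)) is w) = foldr (\<lambda>i u. Yop W' (v i) u (e i)) is (f w)"
  using assms(1)
proof (induct "is")
  case (Cons i "is")
  then show ?case by (simp add: Yop_closed Yop)
qed (simp add: assms(2))

end

lemma Hom_hat_completion:
  "\<phi> \<in> Hom_hat W1 W2 \<Longrightarrow> w \<in> carrier W1 \<Longrightarrow> \<zeta> \<noteq> 0 \<Longrightarrow> \<phi> w \<zeta> m \<in> grade W2 m"
  by (auto simp: Hom_hat_def hat_space_def completion_def)

lemma (in graded) grade_finsum:
  "finite S \<Longrightarrow> (\<And>j. j \<in> S \<Longrightarrow> x j \<in> grade W i) \<Longrightarrow> (\<Oplus>j\<in>S. x j) \<in> grade W i"
proof (induct S rule: finite_induct)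
  case (insert j S)
  then show ?case using grade_closed by (subst finsum_insert) (auto intro!: grade_add)
qed (simp add: finsum_empty zero_in_grade)

text \<open>Supplies the hypothesis on values in \<open>laurent_series_map\<close>: generators take
  values in the completion, and each degree is closed under finite linear combinations.\<close>

lemma H_space_completion:
  assumes "graded_space W2" "\<phi> \<in> H_space N V W1 W2" "w \<in> carrier W1" "\<zeta> \<noteq> 0"
  shows "\<phi> w \<zeta> \<in> completion W2"
proof -
  interpret graded W2 by unfold_locales fact
  from assms(2)[unfolded H_space_def, THEN CollectD] obtain r :: nat and \<psi> c
    where \<psi>: "\<forall>i<r. H_generator N V W1 W2 (\<psi> i)"
    and eq: "\<forall>w\<in>carrier W1. \<forall>\<zeta> m. \<zeta> \<noteq> 0 \<longrightarrow>
      \<phi> w \<zeta> m = (\<Oplus>\<^bsub>W2\<^esub>i\<in>{..<r}. c i \<odot>\<^bsub>W2\<^esub> \<psi> i w \<zeta> m)"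
    by (elim exE conjE)
  have "\<psi> i w \<zeta> m \<in> grade W2 m" if "i < r" for i m
  proof -
    have "\<psi> i \<in> Hom_hat W1 W2" using \<psi> that by (simp add: H_generator_def)
    then show ?thesis using assms(3,4) by (rule Hom_hat_completion)
  qed
  then show ?thesis
    unfolding completion_def using eq assms(3,4) by (auto intro!: grade_finsum grade_smult)
qed

text \<open>The coefficient family \<open>g\<close> in \<open>composability\<close> is constrained
  only on \<open>exponents n\<close>, so agreement there has to suffice.\<close>

lemma poly_value_cong:
  assumes "\<And>a. a \<in> exponents n \<Longrightarrow> q a = q' a"
  shows "poly_value n q x = poly_value n q' x"
  unfolding poly_value_def using assms by (intro sum.cong) auto

section \<open>Transport along a pair of homomorphisms\<close>

locale vertex_hom_pair = \<alpha>: vertex_hom V W1' W1 \<alpha> + \<beta>: vertex_hom V W2 W2' \<beta>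
  for V :: "'v vertex_algebra" and W1' :: "('v, 'a') left_mod" and W1 :: "('v, 'a) left_mod"
    and W2 :: "('v, 'b) left_mod" and W2' :: "('v, 'b') left_mod"
    and \<alpha> :: "'a' \<Rightarrow> 'a" and \<beta> :: "'b \<Rightarrow> 'b'"
begin

text \<open>The construction is contravariant in the source and covariant in the target, which is
  why \<alpha> runs from \<open>W1'\<close> to \<open>W1\<close> and \<beta> from \<open>W2\<close>
  to \<open>W2'\<close>.\<close>

abbreviation transport :: "('a \<Rightarrow> complex \<Rightarrow> complex \<Rightarrow> 'b) \<Rightarrow> 'a' \<Rightarrow> complex \<Rightarrow> complex \<Rightarrow> 'b'" where
  "transport \<phi> \<equiv> \<lambda>w \<zeta> m. \<beta> (\<phi> (\<alpha> w) \<zeta> m)"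

lemma Hom_hat_transport:
  assumes "\<phi> \<in> Hom_hat W1 W2"
  shows "transport \<phi> \<in> Hom_hat W1' W2'"
proof -
  note c = \<beta>.D.grade_closed[OF Hom_hat_completion[OF assms]]
  show ?thesis
    using assms \<beta>.hat_space_map c
    by (simp add: Hom_hat_def \<alpha>.closed \<alpha>.add \<alpha>.smult \<beta>.add \<beta>.smult)
qed

text \<open>The map \<alpha> moves inward through the operators to the right of \<Phi> until it
  reaches \<open>w\<close>; the map \<beta> moves outward through those to the left and is absorbed
  by the functional as its transpose.\<close>

lemma corr_term_transport:
  assumes v: "\<And>i. i < k + l \<Longrightarrow> v i \<in> carrier V" and w: "w \<in> carrier W1'"
    and \<Phi>: "\<And>u n. u \<in> carrier W1 \<Longrightarrow> \<Phi> u n \<in> carrier W2" and w': "w' \<in> graded_dual W2'"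
  shows "corr_term W1' W2' (\<lambda>w n. \<beta> (\<Phi> (\<alpha> w) n)) k l v w w' =
    corr_term W1 W2 \<Phi> k l v (\<alpha> w) (dual_map \<beta> w')"
proof (intro ext)
  fix x e
  let ?u' = "foldr (\<lambda>i u. Yop W1' (v i) u (e i)) [k..<k + l] w"
  let ?u = "foldr (\<lambda>i u. Yop W1 (v i) u (e i)) [k..<k + l] (\<alpha> w)"
  have u: "\<alpha> ?u' = ?u" "?u \<in> carrier W1"
    using \<alpha>.foldr_Yop[of "[k..<k + l]" v w e] v w \<alpha>.closed[of ?u'] by auto
  have "foldr (\<lambda>i u. Yop W2 (v i) u (e i)) [0..<k] (\<Phi> ?u (e (k + l))) \<in> carrier W2"
    and "\<beta> (foldr (\<lambda>i u. Yop W2 (v i) u (e i)) [0..<k] (\<Phi> ?u (e (k + l)))) =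
      foldr (\<lambda>i u. Yop W2' (v i) u (e i)) [0..<k] (\<beta> (\<Phi> ?u (e (k + l))))"
    using \<beta>.foldr_Yop[of "[0..<k]" v "\<Phi> ?u (e (k + l))" e] v \<Phi>[OF u(2)] by simp_all
  then show "corr_term W1' W2' (\<lambda>w n. \<beta> (\<Phi> (\<alpha> w) n)) k l v w w' x e =
    corr_term W1 W2 \<Phi> k l v (\<alpha> w) (dual_map \<beta> w') x e"
    unfolding corr_term_def u(1) by (simp only: flip: \<beta>.pairing_comps_dual_map[OF w'])
qed

text \<open>The terms are equal as functions, so the same \<open>f\<close> is their sum.
  Composability carries correlation functions to the transported map, the degree condition carries
  them back.\<close>

lemma is_correlation_transport:
  assumes "\<And>i. i < k + l \<Longrightarrow> v i \<in> carrier V" "w \<in> carrier W1'"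
    "\<And>u n. u \<in> carrier W1 \<Longrightarrow> \<Phi> u n \<in> carrier W2" "w' \<in> graded_dual W2'"
  shows "is_correlation W1' W2' (\<lambda>w n. \<beta> (\<Phi> (\<alpha> w) n)) k l v w w' f \<longleftrightarrow>
    is_correlation W1 W2 \<Phi> k l v (\<alpha> w) (dual_map \<beta> w') f"
proof -
  have "corr_term W1' W2' (\<lambda>w n. \<beta> (\<Phi> (\<alpha> w) n)) k l v w w' =
      corr_term W1 W2 \<Phi> k l v (\<alpha> w) (dual_map \<beta> w')"
    using assms by (intro corr_term_transport)
  then show ?thesis unfolding is_correlation_def by (simp only:)
qed

lemma composability_transport:
  assumes \<Phi>: "\<And>u n. u \<in> carrier W1 \<Longrightarrow> \<Phi> u n \<in> carrier W2" and comp: "composability V W1 W2 \<Phi>"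
  shows "composability V W1' W2' (\<lambda>w n. \<beta> (\<Phi> (\<alpha> w) n))"
proof -
  from comp[unfolded composability_def]
  obtain r :: "'v \<Rightarrow> 'a \<Rightarrow> nat" and m :: "'a \<Rightarrow> nat" and p :: "'v \<Rightarrow> 'v \<Rightarrow> nat" and s :: "'v \<Rightarrow> nat"
    where *: "\<forall>k l v. \<forall>w\<in>carrier W1. (\<forall>i<k + l. v i \<in> carrier V) \<longrightarrow>
        (\<exists>g :: (nat \<Rightarrow> nat) \<Rightarrow> 'b. (\<forall>a\<in>exponents (k + l). g a \<in> carrier W2) \<and>
          (\<forall>w'\<in>graded_dual W2. \<exists>f. is_correlation W1 W2 \<Phi> k l v w w' f \<and>
             finite {a \<in> exponents (k + l). pairing W2 w' (comps W2 (g a)) \<noteq> 0} \<and>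
             (\<forall>x\<in>configurations (k + l).
                x (k + l) ^ m w * (\<Prod>i<k + l. x i ^ r (v i) w) *
                (\<Prod>j<k + l. \<Prod>i<j. (x i - x j) ^ p (v i) (v j)) *
                (\<Prod>i<k + l. (x i - x (k + l)) ^ s (v i)) * f x =
                poly_value (k + l) (\<lambda>a. pairing W2 w' (comps W2 (g a))) x)))"
    by (elim exE)
  show ?thesis
    unfolding composability_def
  \<comment> \<open>The orders \<open>r\<close> and \<open>m\<close> depend on the vector and are
    evaluated at its image under \<alpha>. The orders \<open>p\<close> and \<open>s\<close> involve
    only elements of \<open>V\<close> and are kept.\<close>
  proof (rule exI[of _ "\<lambda>v w. r v (\<alpha> w)"], rule exI[of _ "\<lambda>w. m (\<alpha> w)"], rule exI[of _ p],
      rule exI[of _ s], intro allI ballI impI)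
    fix k l and v :: "nat \<Rightarrow> 'v" and w assume w: "w \<in> carrier W1'" and v: "\<forall>i<k + l. v i \<in> carrier V"
    from *[THEN spec, of k, THEN spec, of l, THEN spec, of v, THEN bspec, OF \<alpha>.closed[OF w],
        THEN mp, OF v]
    obtain g :: "(nat \<Rightarrow> nat) \<Rightarrow> 'b" where g: "\<forall>a\<in>exponents (k + l). g a \<in> carrier W2"
      and f: "\<forall>w'\<in>graded_dual W2. \<exists>f. is_correlation W1 W2 \<Phi> k l v (\<alpha> w) w' f \<and>
             finite {a \<in> exponents (k + l). pairing W2 w' (comps W2 (g a)) \<noteq> 0} \<and>
             (\<forall>x\<in>configurations (k + l).
                x (k + l) ^ m (\<alpha> w) * (\<Prod>i<k + l. x i ^ r (v i) (\<alpha> w)) *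
                (\<Prod>j<k + l. \<Prod>i<j. (x i - x j) ^ p (v i) (v j)) *
                (\<Prod>i<k + l. (x i - x (k + l)) ^ s (v i)) * f x =
                poly_value (k + l) (\<lambda>a. pairing W2 w' (comps W2 (g a))) x)"
      by (elim exE conjE)
    show "\<exists>g :: (nat \<Rightarrow> nat) \<Rightarrow> 'b'. (\<forall>a\<in>exponents (k + l). g a \<in> carrier W2') \<and>
          (\<forall>w'\<in>graded_dual W2'.
             \<exists>f. is_correlation W1' W2' (\<lambda>w n. \<beta> (\<Phi> (\<alpha> w) n)) k l v w w' f \<and>
             finite {a \<in> exponents (k + l). pairing W2' w' (comps W2' (g a)) \<noteq> 0} \<and>
             (\<forall>x\<in>configurations (k + l).
                x (k + l) ^ m (\<alpha> w) * (\<Prod>i<k + l. x i ^ r (v i) (\<alpha> w)) *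
                (\<Prod>j<k + l. \<Prod>i<j. (x i - x j) ^ p (v i) (v j)) *
                (\<Prod>i<k + l. (x i - x (k + l)) ^ s (v i)) * f x =
                poly_value (k + l) (\<lambda>a. pairing W2' w' (comps W2' (g a))) x))"
    proof (intro exI[of _ "\<lambda>a. \<beta> (g a)"] conjI ballI)
      show "\<beta> (g a) \<in> carrier W2'" if "a \<in> exponents (k + l)" for a
        using g that by (intro \<beta>.closed) blast
      fix w' assume w': "w' \<in> graded_dual W2'"
      have pair: "pairing W2' w' (comps W2' (\<beta> (g a))) =
          pairing W2 (dual_map \<beta> w') (comps W2 (g a))" if "a \<in> exponents (k + l)" for a
        using \<beta>.pairing_comps_dual_map[OF w'] g that by blast
      have supp: "{a \<in> exponents (k + l). pairing W2' w' (comps W2' (\<beta> (g a))) \<noteq> 0} =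
          {a \<in> exponents (k + l). pairing W2 (dual_map \<beta> w') (comps W2 (g a)) \<noteq> 0}"
        using pair by auto
      have pv: "poly_value (k + l) (\<lambda>a. pairing W2' w' (comps W2' (\<beta> (g a)))) x =
          poly_value (k + l) (\<lambda>a. pairing W2 (dual_map \<beta> w') (comps W2 (g a))) x" for x
        by (rule poly_value_cong) (rule pair)
      have corr: "is_correlation W1' W2' (\<lambda>w n. \<beta> (\<Phi> (\<alpha> w) n)) k l v w w' =
          is_correlation W1 W2 \<Phi> k l v (\<alpha> w) (dual_map \<beta> w')"
        using v w w' \<Phi> by (intro ext is_correlation_transport) blast+
      show "\<exists>f. is_correlation W1' W2' (\<lambda>w n. \<beta> (\<Phi> (\<alpha> w) n)) k l v w w' f \<and>
             finite {a \<in> exponents (k + l). pairing W2' w' (comps W2' (\<beta> (g a))) \<noteq> 0} \<and>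
             (\<forall>x\<in>configurations (k + l).
                x (k + l) ^ m (\<alpha> w) * (\<Prod>i<k + l. x i ^ r (v i) (\<alpha> w)) *
                (\<Prod>j<k + l. \<Prod>i<j. (x i - x j) ^ p (v i) (v j)) *
                (\<Prod>i<k + l. (x i - x (k + l)) ^ s (v i)) * f x =
                poly_value (k + l) (\<lambda>a. pairing W2' w' (comps W2' (\<beta> (g a)))) x)"
        unfolding supp pv corr
        using f[THEN bspec, OF \<beta>.dual_map_graded_dual[OF w']] .
    qed
  qed
qed

text \<open>A correlation function of the transported map is one of the original map with the same
  \<open>v\<close>, and the weight \<open>n\<close> is unchanged, so the original expansion and
  degree bound apply.\<close>

lemma weight_degree_transport:
  assumes "graded_space V" and \<Phi>: "\<And>u n. u \<in> carrier W1 \<Longrightarrow> \<Phi> u n \<in> carrier W2"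
    and wd: "weight_degree N V W1 W2 \<Phi> n"
  shows "weight_degree N V W1' W2' (\<lambda>w n. \<beta> (\<Phi> (\<alpha> w) n)) n"
  unfolding weight_degree_def
proof (intro allI ballI impI)
  fix k l v h f w w'
  assume w: "w \<in> carrier W1'" and w': "w' \<in> graded_dual W2'" and l: "1 \<le> l"
    and v: "\<forall>i<k + l. v i \<in> grade V (h i)"
    and corr: "is_correlation W1' W2' (\<lambda>w n. \<beta> (\<Phi> (\<alpha> w) n)) k l v w w' f"
  have vc: "v i \<in> carrier V" if "i < k + l" for i
    using v that graded.grade_closed[OF graded.intro[OF assms(1)]] by blast
  have "is_correlation W1 W2 \<Phi> k l v (\<alpha> w) (dual_map \<beta> w') f"
    using corr is_correlation_transport[of k l v w \<Phi> w' f, OF vc w \<Phi> w'] by blast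
  then show "\<exists>C. is_shifted_expansion k l f C \<and> (\<forall>e\<in>exponents (k + l). C e \<noteq> 0 \<longrightarrow>
      N - (\<Sum>i<k + l. h i) - n \<le> (\<Sum>i\<in>{..k + l} - {k + l - 1}. e i))"
    using wd[unfolded weight_degree_def, rule_format, OF \<alpha>.closed[OF w]
        \<beta>.dual_map_graded_dual[OF w'] l] v by blast
qed

text \<open>Graded maps commute with diagonal operators, so \<alpha> intertwines the operators
  \<open>a powr h\<close>; \<beta> preserves degrees and scalars.\<close>

lemma d_conjugation_transport:
  assumes \<phi>: "\<phi> \<in> Hom_hat W1 W2" and dc: "d_conjugation W1 W2 \<phi> n"
  shows "d_conjugation W1' W2' (transport \<phi>) n"
  unfolding d_conjugation_def
proof (intro allI ballI impI)
  fix a \<zeta> :: complex and w m assume w: "w \<in> carrier W1'" and a: "a \<noteq> 0" and \<zeta>: "\<zeta> \<noteq> 0"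
  note c = \<beta>.D.grade_closed[OF Hom_hat_completion[OF \<phi>]]
  let ?d = "diag_op W1 (\<lambda>h. a powr h) (\<alpha> w)"
  have d: "?d \<in> carrier W1" using \<alpha>.C.diag_op_closed \<alpha>.closed[OF w] .
  have "\<beta> ((a powr m) \<odot>\<^bsub>W2\<^esub> \<phi> (\<alpha> w) \<zeta> m) = \<beta> ((a powi n) \<odot>\<^bsub>W2\<^esub> \<phi> ?d (a * \<zeta>) m)"
    using dc \<alpha>.closed[OF w] a \<zeta> unfolding d_conjugation_def by metis
  then show "(a powr m) \<odot>\<^bsub>W2'\<^esub> \<beta> (\<phi> (\<alpha> w) \<zeta> m) =
      (a powi n) \<odot>\<^bsub>W2'\<^esub> \<beta> (\<phi> (\<alpha> (diag_op W1' (\<lambda>h. a powr h) w)) (a * \<zeta>) m)"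
    using c \<alpha>.closed[OF w] d a \<zeta> by (simp add: \<beta>.smult \<alpha>.diag_op[OF w])
qed

lemma H_generator_transport:
  assumes "graded_space V" "H_generator N V W1 W2 \<phi>"
  shows "H_generator N V W1' W2' (transport \<phi>)"
proof -
  obtain n \<Phi> where \<phi>: "\<phi> \<in> Hom_hat W1 W2"
    and \<Phi>: "\<And>w. w \<in> carrier W1 \<Longrightarrow> laurent_series W2 (\<phi> w) (\<Phi> w)"
    and n: "d_conjugation W1 W2 \<phi> n" "composability V W1 W2 \<Phi>" "weight_degree N V W1 W2 \<Phi> n"
    using assms(2) unfolding H_generator_def by blast
  have c: "\<Phi> u n \<in> carrier W2" if "u \<in> carrier W1" for u n
    using \<Phi>[OF that] by (simp add: laurent_series_def)
  have "laurent_series W2' (transport \<phi> w) (\<lambda>n. \<beta> (\<Phi> (\<alpha> w) n))" if "w \<in> carrier W1'" for w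
    using \<beta>.laurent_series_map[OF \<Phi>] \<alpha>.closed[OF that] \<phi>
    by (simp add: Hom_hat_def hat_space_def)
  moreover have "composability V W1' W2' (\<lambda>w n. \<beta> (\<Phi> (\<alpha> w) n))"
    using c n(2) by (rule composability_transport)
  moreover have "weight_degree N V W1' W2' (\<lambda>w n. \<beta> (\<Phi> (\<alpha> w) n)) n"
    using assms(1) c n(3) by (rule weight_degree_transport)
  ultimately show ?thesis
    unfolding H_generator_def
    using Hom_hat_transport[OF \<phi>] d_conjugation_transport[OF \<phi> n(1)]
    by (intro conjI exI[of _ n] exI[of _ "\<lambda>w n. \<beta> (\<Phi> (\<alpha> w) n)"] ballI)
qed

text \<open>Transport is linear in \<phi> and preserves generators, so a linear combination of
  generators goes to the one with the same coefficients.\<close>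

lemma H_space_transport:
  assumes "graded_space V" "\<phi> \<in> H_space N V W1 W2"
  shows "transport \<phi> \<in> H_space N V W1' W2'"
proof -
  from assms(2)[unfolded H_space_def, THEN CollectD] obtain r :: nat and \<psi> c
    where \<psi>: "\<forall>i<r. H_generator N V W1 W2 (\<psi> i)"
    and eq: "\<forall>w\<in>carrier W1. \<forall>\<zeta> m. \<zeta> \<noteq> 0 \<longrightarrow>
      \<phi> w \<zeta> m = (\<Oplus>\<^bsub>W2\<^esub>i\<in>{..<r}. c i \<odot>\<^bsub>W2\<^esub> \<psi> i w \<zeta> m)"
    by (elim exE conjE)
  have cl: "\<psi> i w \<zeta> m \<in> carrier W2" if "i < r" "w \<in> carrier W1" "\<zeta> \<noteq> 0" for i w \<zeta> m
  proof -
    have "\<psi> i \<in> Hom_hat W1 W2" using \<psi> that(1) by (simp add: H_generator_def)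
    then show ?thesis by (rule \<beta>.D.grade_closed[OF Hom_hat_completion]) fact+
  qed
  have "transport \<phi> w \<zeta> m = (\<Oplus>\<^bsub>W2'\<^esub>i\<in>{..<r}. c i \<odot>\<^bsub>W2'\<^esub> transport (\<psi> i) w \<zeta> m)"
    if w: "w \<in> carrier W1'" and \<zeta>: "\<zeta> \<noteq> 0" for w \<zeta> m
  proof -
    note a = \<alpha>.closed[OF w]
    have "transport \<phi> w \<zeta> m = (\<Oplus>\<^bsub>W2'\<^esub>i\<in>{..<r}. \<beta> (c i \<odot>\<^bsub>W2\<^esub> \<psi> i (\<alpha> w) \<zeta> m))"
      unfolding eq[rule_format, OF a \<zeta>] using cl[OF _ a \<zeta>] by (intro \<beta>.finsum) auto
    also have "\<dots> = (\<Oplus>\<^bsub>W2'\<^esub>i\<in>{..<r}. c i \<odot>\<^bsub>W2'\<^esub> transport (\<psi> i) w \<zeta> m)"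
      using cl[OF _ a \<zeta>] by (intro \<beta>.C.finsum_cong') (auto simp: \<beta>.smult \<beta>.closed)
    finally show ?thesis .
  qed
  moreover have "\<forall>i<r. H_generator N V W1' W2' (transport (\<psi> i))"
    using H_generator_transport[OF assms(1)] \<psi> by blast
  ultimately show ?thesis
    unfolding H_space_def
    by (intro CollectI exI[of _ r] exI[of _ "\<lambda>i. transport (\<psi> i)"] exI[of _ c]) blast
qed

end

section \<open>Submodules and quotients in \<open>\<C>\<^sub>N\<close>\<close>

text \<open>A submodule \<open>B\<close> with a linear complement \<open>A\<close>. The projection
  makes \<open>compl_mod\<close> a graded space, the inclusion does so for
  \<open>sub_mod\<close>.\<close>

locale complemented = vertex_module V W
  for V :: "'v vertex_algebra" and W :: "('v, 'w) left_mod" (structure) +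
  fixes A B :: "'w set"
  assumes vsubmodule: "vsubmodule V W B" and direct: "direct_sum W A B"
begin

sublocale decomposed W A B
  by unfold_locales (fact direct)

lemma comps_B: "b \<in> B \<Longrightarrow> comps W b m \<in> B"
  and Yop_B: "v \<in> carrier V \<Longrightarrow> b \<in> B \<Longrightarrow> Yop W v b n \<in> B"
  using vsubmodule by (simp_all add: vsubmodule_def)

sublocale proj: graded_surj W "compl_mod W A B" "proj W A B"
  using graded comps_B by (rule graded_surj_proj)

sublocale incl: graded_map "sub_mod W B" W "\<lambda>x. x"
  using graded submodules(2) comps_B by (rule graded_map_sub_mod)

end

lemma in_category_CD:
  assumes "in_category_C N V W" "vsubmodule V W B"
  obtains A where "direct_sum W A B" "\<forall>v\<in>carrier V.
    \<exists>\<phi>\<in>H_space N V (compl_mod W A B) (sub_mod W B).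
      \<forall>w\<in>A. laurent_series (sub_mod W B) (\<phi> w) (\<lambda>n. proj W B A (Yop W v w n))"
  using assms unfolding in_category_C_def by blast

section \<open>Closure under submodules\<close>

theorem in_category_C_sub_mod:
  fixes V :: "'v vertex_algebra" and W :: "('v, 'w) left_mod"
  assumes V: "mosva V" and W: "in_category_C N V W" and T: "vsubmodule V W T"
  shows "in_category_C N V (sub_mod W T)"
  unfolding in_category_C_def
proof (intro conjI allI impI)
  have lm: "left_module V W" using W by (simp add: in_category_C_def)
  let ?U = "sub_mod W T"
  show lmU: "left_module V ?U" using V lm T by (rule left_module_sub_mod)
  interpret W: vertex_module V W using V lm by (rule vertex_module.intro)
  interpret U: vertex_module V ?U using V lmU by (rule vertex_module.intro)
  interpret inc: graded_map ?U W "\<lambda>x. x"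
    using T W.graded by (intro graded_map_sub_mod) (auto simp: vsubmodule_def)
  have T_carrier: "t \<in> carrier W" if "t \<in> T" for t using inc.closed that by simp
  fix B assume B: "vsubmodule V ?U B"
  have BT: "B \<subseteq> T"
    using B U.submoduleE(1) by (auto simp: vsubmodule_def)
  have BW: "vsubmodule V W B"
    unfolding vsubmodule_def
  proof (intro conjI ballI allI)
    show "submodule B CC W" using inc.submodule_image[of B] B by (simp add: vsubmodule_def)
    show "Yop W v b n \<in> B" if "v \<in> carrier V" "b \<in> B" for v b n
      using B that by (simp add: vsubmodule_def)
    \<comment> \<open>Components taken in \<open>T\<close> and in \<open>W\<close> agree because the
      inclusion is graded.\<close>
    show "comps W b m \<in> B" if "b \<in> B" for b m
      using B that BT inc.comps[of b] by (auto simp: vsubmodule_def)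
  qed
  obtain A where direct: "direct_sum W A B"
    and H: "\<forall>v\<in>carrier V. \<exists>\<phi>\<in>H_space N V (compl_mod W A B) (sub_mod W B).
      \<forall>w\<in>A. laurent_series (sub_mod W B) (\<phi> w) (\<lambda>n. proj W B A (Yop W v w n))"
    using in_category_CD[OF W BW] .
  interpret D: complemented V W A B
    by unfold_locales (fact BW direct)+
  interpret D_swap: decomposed W B A by (rule D.swap)
  \<comment> \<open>The modular law: as \<open>B \<subseteq> T\<close>, the \<open>A\<close>-part of
    \<open>t \<in> T\<close> is the difference of \<open>t\<close> and its \<open>B\<close>-part and
    so lies in \<open>T\<close>.\<close>
  have direct': "direct_sum ?U (A \<inter> T) B"
    unfolding direct_sum_def
  proof (intro conjI)
    have "A \<inter> T = {x \<in> carrier ?U. x \<in> A}" by auto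
    then show "submodule (A \<inter> T) CC ?U"
      using inc.submodule_vimage[OF D.submodules(1)] by argo
    show "submodule B CC ?U" using B by (simp add: vsubmodule_def)
    show "A \<inter> T \<inter> B = {\<zero>\<^bsub>?U\<^esub>}" using direct BT by (auto simp: direct_sum_def)
    show "A \<inter> T <+>\<^bsub>?U\<^esub> B = carrier ?U"
    proof
      show "A \<inter> T <+>\<^bsub>?U\<^esub> B \<subseteq> carrier ?U"
        using BT U.a_closed by (auto simp: set_add_def')
      show "carrier ?U \<subseteq> A \<inter> T <+>\<^bsub>?U\<^esub> B"
      proof
        fix t assume "t \<in> carrier ?U"
        then have t: "t \<in> T" by simp
        obtain a b where ab: "a \<in> A" "b \<in> B" "t = a \<oplus>\<^bsub>W\<^esub> b"
          using D.decompose[OF T_carrier[OF t]] by blast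
        have "a = t \<ominus>\<^bsub>W\<^esub> b"
          using ab D.sub by (simp add: a_minus_def W.a_assoc W.r_neg)
        also have "\<dots> = t \<ominus>\<^bsub>?U\<^esub> b" using inc.minus[of t b] t ab BT by auto
        also have "\<dots> \<in> T" using U.minus_closed[of t b] t ab BT by auto
        finally show "t \<in> A \<inter> T <+>\<^bsub>?U\<^esub> B" using ab by (auto simp: set_add_def')
      qed
    qed
  qed
  interpret E: complemented V ?U "A \<inter> T" B
    by unfold_locales (fact B direct')+
  \<comment> \<open>A decomposition in \<open>T\<close> is also the one in \<open>W\<close>, so both
    projections are restrictions.\<close>
  have proj_A: "proj ?U (A \<inter> T) B t = proj W A B t"
    and proj_B: "proj ?U B (A \<inter> T) t = proj W B A t" if "t \<in> T" for t
  proof -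
    have "t \<in> carrier ?U" using that by simp
    then obtain a b where ab': "a \<in> A \<inter> T" "b \<in> B" "t = a \<oplus>\<^bsub>?U\<^esub> b"
        "proj ?U (A \<inter> T) B t = a"
      by (rule E.decompose)
    then have ab: "a \<in> A \<inter> T" "b \<in> B" "t = a \<oplus>\<^bsub>W\<^esub> b" "proj ?U (A \<inter> T) B t = a"
      by simp_all
    then have "t = b \<oplus>\<^bsub>W\<^esub> a" using D.sub W.a_comm by blast
    then show "proj ?U B (A \<inter> T) t = proj W B A t"
      using decomposed.proj_eqI[OF E.swap, of b a t] D_swap.proj_eqI[of b a t] ab by simp
    show "proj ?U (A \<inter> T) B t = proj W A B t" using D.proj_eqI[of a b t] ab by simp
  qed
  \<comment> \<open>An equality of records, so the homomorphism on the target side can be the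
    identity.\<close>
  have sub_sub: "sub_mod ?U B = sub_mod W B"
  proof -
    have "grade W m \<inter> T \<inter> B = grade W m \<inter> B" for m using BT by blast
    then show ?thesis by (simp add: sub_mod_def)
  qed
  \<comment> \<open>The inclusion of complements respects vertex operators: \<open>Y\<close>
    preserves \<open>T\<close>, where the two projections onto the complements agree.\<close>
  have \<alpha>: "vertex_hom V (compl_mod ?U (A \<inter> T) B) (compl_mod W A B) (\<lambda>x. x)"
  proof (intro vertex_hom.intro graded_map.intro linear_map.intro graded_map_axioms.intro
      vertex_hom_axioms.intro)
    fix u w n assume u: "u \<in> carrier V" and "w \<in> carrier (compl_mod ?U (A \<inter> T) B)"
    then have y: "Yop W u w n \<in> T" using U.Y(1)[OF u, of w n] by simp
    show "Yop (compl_mod ?U (A \<inter> T) B) u w n \<in> carrier (compl_mod ?U (A \<inter> T) B)"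
      using E.proj.closed[of "Yop W u w n"] y by simp
    show "Yop (compl_mod ?U (A \<inter> T) B) u w n = Yop (compl_mod W A B) u w n"
      using y by (simp add: proj_A)
  next
    fix x m assume "x \<in> grade (compl_mod ?U (A \<inter> T) B) m"
    then obtain t where "t \<in> grade W m" "t \<in> T" "x = proj ?U (A \<inter> T) B t" by auto
    then show "x \<in> grade (compl_mod W A B) m" by (simp add: proj_A)
  qed (fact E.proj.cod D.proj.cod E.proj.graded_space_image D.proj.graded_space_image
      | simp)+
  have \<beta>: "vertex_hom V (sub_mod W B) (sub_mod W B) (\<lambda>x. x)"
    by (intro vertex_hom.intro graded_map.intro linear_map.intro graded_map_axioms.intro
      vertex_hom_axioms.intro D.incl.dom D.incl.graded_dom) (simp_all add: D.Yop_B)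
  note transport = vertex_hom_pair.H_space_transport[OF vertex_hom_pair.intro[OF \<alpha> \<beta>]]
  show "\<exists>A. direct_sum ?U A B \<and>
    (\<forall>v\<in>carrier V. \<exists>\<phi>\<in>H_space N V (compl_mod ?U A B) (sub_mod ?U B).
       \<forall>w\<in>A. laurent_series (sub_mod ?U B) (\<phi> w) (\<lambda>n. proj ?U B A (Yop ?U v w n)))"
  proof (intro exI[of _ "A \<inter> T"] conjI ballI direct')
    fix v assume v: "v \<in> carrier V"
    obtain \<phi> where \<phi>: "\<phi> \<in> H_space N V (compl_mod W A B) (sub_mod W B)"
      and l: "\<forall>w\<in>A. laurent_series (sub_mod W B) (\<phi> w) (\<lambda>n. proj W B A (Yop W v w n))"
      using H v by blast
    show "\<exists>\<phi>\<in>H_space N V (compl_mod ?U (A \<inter> T) B) (sub_mod ?U B). \<forall>w\<in>A \<inter> T.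
        laurent_series (sub_mod ?U B) (\<phi> w) (\<lambda>n. proj ?U B (A \<inter> T) (Yop ?U v w n))"
      unfolding sub_sub
    \<comment> \<open>Both homomorphisms are identity functions, so transport leaves \<phi> as a
      function unchanged and only restricts its source.\<close>
    proof (intro bexI[of _ \<phi>] ballI)
      show "\<phi> \<in> H_space N V (compl_mod ?U (A \<inter> T) B) (sub_mod W B)"
        using transport[OF W.V.graded \<phi>] .
      fix w assume w: "w \<in> A \<inter> T"
      then have "Yop W v w n \<in> T" for n using U.Y(1)[OF v, of w n] by simp
      then show "laurent_series (sub_mod W B) (\<phi> w) (\<lambda>n. proj ?U B (A \<inter> T) (Yop ?U v w n))"
        using l w by (simp add: proj_B)
    qed
  qed
qed

section \<open>Closure under quotients\<close>

theorem in_category_C_quot_mod: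
  fixes V :: "'v vertex_algebra" and W :: "('v, 'w) left_mod"
  assumes V: "mosva V" and W: "in_category_C N V W" and T: "vsubmodule V W T"
  shows "in_category_C N V (quot_mod W T)"
  unfolding in_category_C_def
proof (intro conjI allI impI)
  have lm: "left_module V W" using W by (simp add: in_category_C_def)
  let ?Q = "quot_mod W T"
  interpret W: vertex_module V W using V lm by (rule vertex_module.intro)
  interpret quotient W T
    using T W.module_axioms by (intro quotient.intro) (simp_all add: vsubmodule_def)
  have comps_T: "comps W t m \<in> T" if "t \<in> T" for t m using T that by (simp add: vsubmodule_def)
  interpret coset: graded_surj W ?Q coset
    using W.graded comps_T by (rule graded_surj_coset)
  have Yop_coset: "Yop ?Q u (coset w) n = coset (Yop W u w n)"
    if u: "u \<in> carrier V" and w: "w \<in> carrier W" for u w n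
  proof -
    \<comment> \<open>For fixed \<open>u\<close> and \<open>n\<close> the coefficient map is linear
      and preserves \<open>T\<close>, so \<open>coset_lift\<close> computes the union defining
      \<open>Yop\<close> on cosets.\<close>
    have "linear_map W W (\<lambda>x. Yop W u x n)"
      using W.module_axioms u by (intro linear_map.intro) (simp_all add: W.Y)
    then show ?thesis
      using coset_lift[of "\<lambda>x. Yop W u x n" w] T u w by (simp add: quot_mod_def vsubmodule_def)
  qed
  show lmQ: "left_module V ?Q"
    using V lm coset.graded_surj_axioms Yop_coset by (rule left_module_image)
  interpret Q: vertex_module V ?Q using V lmQ by (rule vertex_module.intro)
  fix B' assume B': "vsubmodule V ?Q B'"
  \<comment> \<open>The submodule of \<open>W\<close> corresponding to \<open>B'\<close>; it
    contains \<open>T\<close>.\<close>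
  define B where "B = {w \<in> carrier W. coset w \<in> B'}"
  have B: "vsubmodule V W B"
    unfolding vsubmodule_def
  proof (intro conjI ballI allI)
    show "submodule B CC W"
      unfolding B_def using B' by (intro coset.submodule_vimage) (simp add: vsubmodule_def)
    fix b assume "b \<in> B"
    then have b: "b \<in> carrier W" "coset b \<in> B'" by (simp_all add: B_def)
    show "Yop W v b n \<in> B" if v: "v \<in> carrier V" for v n
      using B' b v by (simp add: B_def W.Y vsubmodule_def flip: Yop_coset)
    show "comps W b m \<in> B" for m
      using B' b coset.comps[OF b(1)] by (simp add: B_def W.comps_closed vsubmodule_def) metis
  qed
  have B'_carrier: "B' \<subseteq> coset ` carrier W"
    using B' coset.C.submoduleE(1)[of B'] by (simp add: vsubmodule_def)
  obtain A where direct: "direct_sum W A B"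
    and H: "\<forall>v\<in>carrier V. \<exists>\<phi>\<in>H_space N V (compl_mod W A B) (sub_mod W B).
      \<forall>w\<in>A. laurent_series (sub_mod W B) (\<phi> w) (\<lambda>n. proj W B A (Yop W v w n))"
    using in_category_CD[OF W B] .
  interpret D: complemented V W A B
    by unfold_locales (fact B direct)+
  interpret D_swap: decomposed W B A by (rule D.swap)
  define A' where "A' = coset ` A"
  have direct': "direct_sum ?Q A' B'"
    unfolding direct_sum_def
  proof (intro conjI)
    show "submodule A' CC ?Q" unfolding A'_def by (rule coset.submodule_image[OF D.submodules(1)])
    show B'_sub: "submodule B' CC ?Q" using B' by (simp add: vsubmodule_def)
    show "A' \<inter> B' = {\<zero>\<^bsub>?Q\<^esub>}"
    proof
      have "coset \<zero>\<^bsub>W\<^esub> \<in> A'" "coset \<zero>\<^bsub>W\<^esub> \<in> B'"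
        using D.zeros by (auto simp: A'_def B_def)
      then show "{\<zero>\<^bsub>?Q\<^esub>} \<subseteq> A' \<inter> B'" by (simp add: coset_zero)
      show "A' \<inter> B' \<subseteq> {\<zero>\<^bsub>?Q\<^esub>}"
      proof
        fix X assume X: "X \<in> A' \<inter> B'"
        then obtain a where a: "a \<in> A" "X = coset a" by (auto simp: A'_def)
        \<comment> \<open>The coset of \<open>a\<close> lies in \<open>B'\<close>, so
          \<open>a\<close> lies in the preimage \<open>B\<close>.\<close>
        then have "a \<in> A \<inter> B" using X D.sub(1)[OF a(1)] by (simp add: B_def)
        then have "a = \<zero>\<^bsub>W\<^esub>" using direct by (auto simp: direct_sum_def)
        then show "X \<in> {\<zero>\<^bsub>?Q\<^esub>}" using a by (simp add: coset_zero)
      qed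
    qed
    show "A' <+>\<^bsub>?Q\<^esub> B' = carrier ?Q"
    proof
      have "x \<in> carrier ?Q" if "x \<in> A' \<union> B'" for x
        using that B'_carrier D.sub by (auto simp: A'_def)
      then show "A' <+>\<^bsub>?Q\<^esub> B' \<subseteq> carrier ?Q"
        using coset.C.a_closed unfolding set_add_def' by blast
      show "carrier ?Q \<subseteq> A' <+>\<^bsub>?Q\<^esub> B'"
      proof
        fix X assume "X \<in> carrier ?Q"
        then obtain w where w: "w \<in> carrier W" "X = coset w" by auto
        obtain a b where ab: "a \<in> A" "b \<in> B" "w = a \<oplus>\<^bsub>W\<^esub> b" using D.decompose[OF w(1)] .
        have "X = coset a \<oplus>\<^bsub>?Q\<^esub> coset b"
          unfolding w(2) ab(3) using D.sub ab by (intro coset.add) blast+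
        moreover have "coset a \<in> A'" "coset b \<in> B'" using ab by (simp_all add: A'_def B_def)
        ultimately show "X \<in> A' <+>\<^bsub>?Q\<^esub> B'" unfolding set_add_def' by blast
      qed
    qed
  qed
  interpret E: complemented V ?Q A' B'
    by unfold_locales (fact B' direct')+
  \<comment> \<open>The coset map sends the decomposition of \<open>w\<close> to a decomposition of
    its coset.\<close>
  have proj_A: "proj ?Q A' B' (coset w) = coset (proj W A B w)"
    and proj_B: "proj ?Q B' A' (coset w) = coset (proj W B A w)" if w: "w \<in> carrier W" for w
  proof -
    obtain a b where ab: "a \<in> A" "b \<in> B" "w = a \<oplus>\<^bsub>W\<^esub> b" "proj W A B w = a"
      using D.decompose[OF w] .
    have ba: "w = b \<oplus>\<^bsub>W\<^esub> a" using ab D.sub W.a_comm by blast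
    have mem: "coset a \<in> A'" "coset b \<in> B'" using ab by (simp_all add: A'_def B_def)
    have cs: "a \<in> carrier W" "b \<in> carrier W" using ab D.sub by blast+
    have "coset w = coset a \<oplus>\<^bsub>?Q\<^esub> coset b"
      unfolding ab(3) using cs by (rule coset.add)
    then show "proj ?Q A' B' (coset w) = coset (proj W A B w)"
      unfolding ab(4) by (rule E.proj_eqI[OF mem])
    have "coset w = coset b \<oplus>\<^bsub>?Q\<^esub> coset a"
      unfolding ba using cs(2,1) by (rule coset.add)
    then show "proj ?Q B' A' (coset w) = coset (proj W B A w)"
      unfolding D_swap.proj_eqI[OF ab(2,1) ba] by (rule decomposed.proj_eqI[OF E.swap mem(2,1)])
  qed
  \<comment> \<open>The inverse of the coset map from \<open>A\<close> to \<open>A'\<close>: take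
    any representative and project it onto \<open>A\<close> along \<open>B\<close>. As
    \<open>T \<subseteq> B\<close>, the choice does not affect the result.\<close>
  define \<alpha> where "\<alpha> X = proj W A B (SOME w. w \<in> X)" for X
  have TB: "t \<in> B" if "t \<in> T" for t
  proof -
    have t: "t \<in> carrier W" using that T.a_subset by blast
    have "coset t = coset \<zero>\<^bsub>W\<^esub>" using that t by (simp add: coset_eq_zero coset_zero)
    then show ?thesis using t D.zeros(2) by (simp add: B_def)
  qed
  have \<alpha>: "\<alpha> (coset a) = a" if a: "a \<in> A" for a
  proof -
    have ac: "a \<in> carrier W" using a by (rule D.sub)
    define x where "x = (SOME w. w \<in> coset a)"
    have x: "x \<in> coset a" unfolding x_def using coset_self[OF ac] by (rule someI)
    have xc: "x \<in> carrier W" using coset_carrier[OF x ac] .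
    \<comment> \<open>Representatives differ by an element of \<open>T\<close>, hence of
      \<open>B\<close>, so the \<open>A\<close>-part of \<open>x\<close> is
      \<open>a\<close>.\<close>
    have "x \<ominus>\<^bsub>W\<^esub> a \<in> B" using coset_eqI[OF x ac] coset_eq_iff[OF xc ac] TB by blast
    moreover have "x = a \<oplus>\<^bsub>W\<^esub> (x \<ominus>\<^bsub>W\<^esub> a)"
      using xc ac by (simp add: a_minus_def W.add.m_lcomm[of a x] W.r_neg)
    ultimately show ?thesis
      unfolding \<alpha>_def x_def[symmetric] using D.proj_eqI a by blast
  qed
  have \<alpha>_hom: "vertex_hom V (compl_mod ?Q A' B') (compl_mod W A B) \<alpha>"
  proof (intro vertex_hom.intro graded_map.intro linear_map.intro graded_map_axioms.intro
      vertex_hom_axioms.intro)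
    show "\<alpha> X \<in> carrier (compl_mod W A B)" if "X \<in> carrier (compl_mod ?Q A' B')" for X
      using that \<alpha> by (auto simp: A'_def)
    show "\<alpha> (X \<oplus>\<^bsub>compl_mod ?Q A' B'\<^esub> Y) = \<alpha> X \<oplus>\<^bsub>compl_mod W A B\<^esub> \<alpha> Y"
      if XY: "X \<in> carrier (compl_mod ?Q A' B')" "Y \<in> carrier (compl_mod ?Q A' B')" for X Y
    proof -
      obtain a a' where a: "a \<in> A" "X = coset a" "a' \<in> A" "Y = coset a'"
        using XY by (auto simp: A'_def)
      then have "X \<oplus>\<^bsub>?Q\<^esub> Y = coset (a \<oplus>\<^bsub>W\<^esub> a')" using coset.add D.sub by simp
      then show ?thesis using a \<alpha> D.A(5) by simp
    qed
    show "\<alpha> (c \<odot>\<^bsub>compl_mod ?Q A' B'\<^esub> X) = c \<odot>\<^bsub>compl_mod W A B\<^esub> \<alpha> X"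
      if X: "X \<in> carrier (compl_mod ?Q A' B')" for c X
    proof -
      obtain a where a: "a \<in> A" "X = coset a" using X by (auto simp: A'_def)
      then have "c \<odot>\<^bsub>?Q\<^esub> X = coset (c \<odot>\<^bsub>W\<^esub> a)" using coset.smult D.sub by simp
      then show ?thesis using a \<alpha> D.A(4) by simp
    qed
    show "\<alpha> X \<in> grade (compl_mod W A B) m" if X: "X \<in> grade (compl_mod ?Q A' B') m" for X m
    proof -
      obtain w where w: "w \<in> grade W m" "X = proj ?Q A' B' (coset w)" using X by auto
      \<comment> \<open>A homogeneous element of \<open>A'\<close> is thus the coset of a
        homogeneous element of \<open>compl_mod W A B\<close>, which \<alpha> recovers.\<close>
      then have "X = coset (proj W A B w)" using proj_A W.grade_closed by blast
      moreover have "proj W A B w \<in> A" using D.proj.closed[of w] W.grade_closed w by simp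
      ultimately show ?thesis using \<alpha> w by simp
    qed
    fix u X n assume u: "u \<in> carrier V" and "X \<in> carrier (compl_mod ?Q A' B')"
    then obtain a where a: "a \<in> A" "X = coset a" by (auto simp: A'_def)
    have ac: "a \<in> carrier W" using a(1) by (rule D.sub)
    have y: "Yop W u a n \<in> carrier W" using u ac by (rule W.Y)
    have eq: "Yop (compl_mod ?Q A' B') u X n = coset (proj W A B (Yop W u a n))"
      using proj_A[OF y] Yop_coset[OF u ac] a by simp
    have pA: "proj W A B (Yop W u a n) \<in> A" using D.proj.closed[OF y] by simp
    show "Yop (compl_mod ?Q A' B') u X n \<in> carrier (compl_mod ?Q A' B')"
      unfolding eq using pA by (simp add: A'_def)
    show "\<alpha> (Yop (compl_mod ?Q A' B') u X n) = Yop (compl_mod W A B) u (\<alpha> X) n"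
      unfolding eq using pA a \<alpha> by simp
  qed (fact E.proj.cod D.proj.cod E.proj.graded_space_image D.proj.graded_space_image)+
  have \<beta>_hom: "vertex_hom V (sub_mod W B) (sub_mod ?Q B') coset"
  proof (intro vertex_hom.intro graded_map.intro linear_map.intro graded_map_axioms.intro
      vertex_hom_axioms.intro D.incl.dom D.incl.graded_dom E.incl.dom E.incl.graded_dom)
    fix u w n assume "u \<in> carrier V" "w \<in> carrier (sub_mod W B)"
    then show "Yop (sub_mod W B) u w n \<in> carrier (sub_mod W B)"
      and "coset (Yop (sub_mod W B) u w n) = Yop (sub_mod ?Q B') u (coset w) n"
      using D.Yop_B D.sub Yop_coset by simp_all
  next
    fix x y c assume "x \<in> carrier (sub_mod W B)"
    then show "coset (c \<odot>\<^bsub>sub_mod W B\<^esub> x) = c \<odot>\<^bsub>sub_mod ?Q B'\<^esub> coset x"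
      using coset.smult D.sub by simp
  next
    fix x y assume "x \<in> carrier (sub_mod W B)" "y \<in> carrier (sub_mod W B)"
    then show "coset (x \<oplus>\<^bsub>sub_mod W B\<^esub> y) = coset x \<oplus>\<^bsub>sub_mod ?Q B'\<^esub> coset y"
      using coset.add D.sub by simp
  qed (auto simp: B_def)
  note transport = vertex_hom_pair.H_space_transport[OF vertex_hom_pair.intro[OF \<alpha>_hom \<beta>_hom]]
  show "\<exists>A. direct_sum ?Q A B' \<and>
    (\<forall>v\<in>carrier V. \<exists>\<phi>\<in>H_space N V (compl_mod ?Q A B') (sub_mod ?Q B').
       \<forall>X\<in>A. laurent_series (sub_mod ?Q B') (\<phi> X) (\<lambda>n. proj ?Q B' A (Yop ?Q v X n)))"
  proof (intro exI[of _ A'] conjI ballI direct')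
    fix v assume v: "v \<in> carrier V"
    obtain \<phi> where \<phi>: "\<phi> \<in> H_space N V (compl_mod W A B) (sub_mod W B)"
      and l: "\<forall>w\<in>A. laurent_series (sub_mod W B) (\<phi> w) (\<lambda>n. proj W B A (Yop W v w n))"
      using H v by blast
    show "\<exists>\<phi>\<in>H_space N V (compl_mod ?Q A' B') (sub_mod ?Q B'). \<forall>X\<in>A'.
        laurent_series (sub_mod ?Q B') (\<phi> X) (\<lambda>n. proj ?Q B' A' (Yop ?Q v X n))"
    \<comment> \<open>The transport of \<phi> along \<alpha> and the coset map from \<open>B\<close>
      to \<open>B'\<close>.\<close>
    proof (intro bexI[of _ "\<lambda>X \<zeta> m. coset (\<phi> (\<alpha> X) \<zeta> m)"] ballI)
      show "(\<lambda>X \<zeta> m. coset (\<phi> (\<alpha> X) \<zeta> m)) \<in> H_space N V (compl_mod ?Q A' B') (sub_mod ?Q B')"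
        using W.V.graded \<phi> by (rule transport)
      fix X assume "X \<in> A'"
      then obtain a where a: "a \<in> A" "X = coset a" by (auto simp: A'_def)
      have ac: "a \<in> carrier W" using a(1) by (rule D.sub)
      have "\<phi> a \<zeta> \<in> completion (sub_mod W B)" if "\<zeta> \<noteq> 0" for \<zeta>
        using H_space_completion[OF D.incl.graded_dom \<phi> _ that, of a] a by simp
      moreover have "laurent_series (sub_mod W B) (\<phi> a) (\<lambda>n. proj W B A (Yop W v a n))"
        using l a by blast
      ultimately have "laurent_series (sub_mod ?Q B') (\<lambda>\<zeta> m. coset (\<phi> a \<zeta> m))
          (\<lambda>n. coset (proj W B A (Yop W v a n)))"
        by (intro vertex_hom.laurent_series_map[OF \<beta>_hom])
      \<comment> \<open>Here \<alpha> returns \<open>a\<close> from \<open>X\<close>, and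
        \<open>Yop_coset\<close> with \<open>proj_B\<close> identifies the coefficients with those
        of the quotient.\<close>
      then show "laurent_series (sub_mod ?Q B') (\<lambda>\<zeta> m. coset (\<phi> (\<alpha> X) \<zeta> m))
          (\<lambda>n. proj ?Q B' A' (Yop ?Q v X n))"
        using a \<alpha> ac v by (simp add: Yop_coset proj_B W.Y)
    qed
  qed
qed

theorem proposition4p4:
  fixes V :: "'v vertex_algebra" and W :: "('v, 'w) left_mod" and N :: int and T :: "'w set"
  assumes "mosva V"
    and "in_category_C N V W"
    and "vsubmodule V W T"
  shows "in_category_C N V (sub_mod W T) \<and> in_category_C N V (quot_mod W T)"
  using in_category_C_sub_mod[OF assms] in_category_C_quot_mod[OF assms] ..

end
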